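(* Let $\beta\in(0,1/2)$ and let $(\mathcal{T}_n)_{n\ge1}$ be the recursive trees with limited memory in the mesoscopic regime, $j(n)=n-\lfloor n^\beta\rfloor$. Then, as $n\to\infty$, $$\frac{1-\beta}{2}\,n^{-(1-\beta)}\,\mathcal{T}_n\longrightarrow L\quad\text{in probability}$$ in the Gromov--Hausdorff topology, where $L$ is a line segment of length $1$.
   Context: **Model.** $\mathcal{T}_1$ is the tree with the single vertex $1$ (the root of all the trees) and no edges. Given $\mathcal{T}_n$ (vertex set $\{1,\dots,n\}$), $\mathcal{T}_{n+1}$ is obtained by adding vertex $n+1$ and an edge between $n+1$ and a vertex chosen uniformly at random, independently of the past, from $\{v\in\{1,\dots,n\}: j(n)\le v\le n\}$. Mesoscopic regime: $j(n)=n-\lfloor n^\beta\rfloor$. For a tree $T$ and $c>0$, $cT$ denotes the metric space of $T$ with its graph distance multiplied by $c$. *)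

theory Defs
  imports "HOL-Probability.Probability"
begin

section \<open>Hausdorff and Gromov--Hausdorff distance\<close>

text \<open>Meaningful for nonempty bounded sets; otherwise the infimum may be over the empty set.\<close>

definition hausdorff_dist :: "'a metric \<Rightarrow> 'a set \<Rightarrow> 'a set \<Rightarrow> real" where
  "hausdorff_dist Z A B =
     Inf {r. r > 0 \<and> A \<subseteq> (\<Union>b\<in>B. mball_of Z b r) \<and> B \<subseteq> (\<Union>a\<in>A. mball_of Z a r)}"

definition isometric_embedding :: "'a metric \<Rightarrow> 'b metric \<Rightarrow> ('a \<Rightarrow> 'b) \<Rightarrow> bool" where
  "isometric_embedding X Z f \<longleftrightarrow> f \<in> mspace X \<rightarrow> mspace Z \<and>
     (\<forall>x\<in>mspace X. \<forall>y\<in>mspace X. mdist Z (f x) (f y) = mdist X x y)"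

text \<open>The infimum over all metric spaces \<open>Z\<close> and all isometric embeddings of \<open>X\<close> and \<open>Y\<close>
  into \<open>Z\<close>. It loses nothing to let \<open>Z\<close> range only over metrics with points in the sum type:
  replacing \<open>Z\<close> by the union of the two images does not change the Hausdorff distance, and that
  union injects into the sum type.\<close>

definition GH_dist :: "'a metric \<Rightarrow> 'b metric \<Rightarrow> real" where
  "GH_dist X Y =
     Inf {hausdorff_dist Z (f ` mspace X) (g ` mspace Y) | (Z :: ('a + 'b) metric) f g.
            isometric_embedding X Z f \<and> isometric_embedding Y Z g}"

definition GH_tendsto_in_prob ::
  "'w measure \<Rightarrow> (nat \<Rightarrow> 'w \<Rightarrow> 'a metric) \<Rightarrow> 'b metric \<Rightarrow> bool" where
  "GH_tendsto_in_prob M X Y \<longleftrightarrow>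
     (\<forall>\<epsilon>>0. (\<lambda>n. measure M {\<omega> \<in> space M. GH_dist (X n \<omega>) Y > \<epsilon>}) \<longlonglongrightarrow> 0)"

definition scale_metric :: "real \<Rightarrow> 'a metric \<Rightarrow> 'a metric" where
  "scale_metric c X = metric (mspace X, \<lambda>x y. c * mdist X x y)"

definition unit_segment :: "real metric" where
  "unit_segment = submetric euclidean_metric {0..1}"

section \<open>Recursive trees with limited memory\<close>

text \<open>A graph is given by its symmetric edge relation. Vertex \<open>n + 1\<close> is attached to \<open>p n\<close>.\<close>

fun tree_edges :: "(nat \<Rightarrow> nat) \<Rightarrow> nat \<Rightarrow> nat rel" where
  "tree_edges p 0 = {}"
| "tree_edges p (Suc 0) = {}"
| "tree_edges p (Suc (Suc n)) =
     tree_edges p (Suc n) \<union> {(Suc (Suc n), p (Suc n)), (p (Suc n), Suc (Suc n))}"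

text \<open>Length of a shortest walk; unspecified for vertices in different components.\<close>

definition graph_dist :: "'a rel \<Rightarrow> 'a \<Rightarrow> 'a \<Rightarrow> nat" where
  "graph_dist E u v = (LEAST k. (u, v) \<in> E ^^ k)"

definition tree_metric :: "(nat \<Rightarrow> nat) \<Rightarrow> nat \<Rightarrow> nat metric" where
  "tree_metric p n = metric ({1..n}, \<lambda>u v. real (graph_dist (tree_edges p n) u v))"

text \<open>As the tree on \<open>n\<close> vertices is a function of \<open>V 1, \<dots>, V (n - 1)\<close> (and conversely),
  independence of each choice from the past is mutual independence of the \<open>V n\<close>.\<close>

locale limited_memory_trees = prob_space M
  for M :: "'w measure" +
  fixes j :: "nat \<Rightarrow> int"
    and V :: "nat \<Rightarrow> 'w \<Rightarrow> nat"
  assumes indep_choices: "indep_vars (\<lambda>_. count_space UNIV) V {1..}"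
    and uniform_choice: "\<And>n. n \<ge> 1 \<Longrightarrow>
      distr M (count_space UNIV) (V n) = measure_pmf (pmf_of_set {v \<in> {1..n}. j n \<le> int v})"

section \<open>Well-definedness\<close>

lemma tree_edges_sym: "sym (tree_edges p n)"
  by (induction p n rule: tree_edges.induct) (auto simp: sym_def)

lemma tree_edges_cong:
  "(\<And>k. k \<in> {1..<n} \<Longrightarrow> p k = q k) \<Longrightarrow> tree_edges p n = tree_edges q n"
  by (induction p n rule: tree_edges.induct) auto

lemma tree_edges_connected:
  assumes "\<And>k. k \<in> {1..<n} \<Longrightarrow> p k \<in> {1..k}" "v \<in> {1..n}"
  shows "(v, 1) \<in> (tree_edges p n)\<^sup>*"
  using assms
proof (induction p n arbitrary: v rule: tree_edges.induct)
  case (3 p n)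
  let ?E = "tree_edges p (Suc (Suc n))"
  have sub: "(u, 1) \<in> ?E\<^sup>*" if "u \<in> {1..Suc n}" for u
  proof -
    have "(u, 1) \<in> (tree_edges p (Suc n))\<^sup>*"
      using 3 that by auto
    moreover have "(tree_edges p (Suc n))\<^sup>* \<subseteq> ?E\<^sup>*"
      by (rule rtrancl_mono) auto
    ultimately show ?thesis by blast
  qed
  show ?case
  proof (cases "v = Suc (Suc n)")
    case True
    have "p (Suc n) \<in> {1..Suc n}" using 3(2)[of "Suc n"] by auto
    from sub[OF this] have "(Suc (Suc n), 1) \<in> ?E\<^sup>*"
      by (rule converse_rtrancl_into_rtrancl[rotated]) auto
    with True show ?thesis by simp
  qed (use sub 3 in auto)
qed auto

lemma sym_relpow: "sym E \<Longrightarrow> (u, v) \<in> E ^^ k \<longleftrightarrow> (v, u) \<in> E ^^ k"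
proof -
  assume s: "sym E"
  have "(v, u) \<in> E ^^ k" if "(u, v) \<in> E ^^ k" for u v
    using that
  proof (induction k arbitrary: v)
    case (Suc k)
    then obtain w where "(u, w) \<in> E ^^ k" "(w, v) \<in> E" by auto
    then show ?case using Suc.IH s by (meson relpow_Suc_I2 symD)
  qed auto
  then show ?thesis by blast
qed

lemma Metric_space_tree:
  assumes p: "\<And>k. k \<in> {1..<n} \<Longrightarrow> p k \<in> {1..k}"
  shows "Metric_space {1..n} (\<lambda>u v. real (graph_dist (tree_edges p n) u v))"
proof
  let ?E = "tree_edges p n"
  have conn: "(u, v) \<in> ?E ^^ graph_dist ?E u v" if "u \<in> {1..n}" "v \<in> {1..n}" for u v
  proof -
    have "(u, 1) \<in> ?E\<^sup>*" "(v, 1) \<in> ?E\<^sup>*"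
      using tree_edges_connected p that by blast+
    then have "(u, v) \<in> ?E\<^sup>*"
      by (meson rtrancl_trans sym_rtrancl symD tree_edges_sym)
    then show ?thesis
      unfolding graph_dist_def by (metis LeastI_ex rtrancl_imp_relpow)
  qed
  show "real (graph_dist ?E u v) = real (graph_dist ?E v u)" for u v
    by (simp add: graph_dist_def sym_relpow[OF tree_edges_sym, of u v])
  show "(real (graph_dist ?E u v) = 0) = (u = v)" if "u \<in> {1..n}" "v \<in> {1..n}" for u v
    using conn[OF that] by (auto simp: graph_dist_def)
  show "real (graph_dist ?E u w) \<le> real (graph_dist ?E u v) + real (graph_dist ?E v w)"
    if "u \<in> {1..n}" "v \<in> {1..n}" "w \<in> {1..n}" for u v w
  proof -
    have "(u, w) \<in> ?E ^^ (graph_dist ?E u v + graph_dist ?E v w)"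
      using conn that by (auto simp: relpow_add)
    then have "graph_dist ?E u w \<le> graph_dist ?E u v + graph_dist ?E v w"
      unfolding graph_dist_def[of _ u w] by (rule Least_le)
    then show ?thesis by linarith
  qed
qed simp

context limited_memory_trees
begin

lemma measurable_V: "n \<ge> 1 \<Longrightarrow> V n \<in> measurable M (count_space UNIV)"
  using indep_choices unfolding indep_vars_def by auto

lemma measurable_tree: "(\<lambda>\<omega>. F (tree_metric (\<lambda>k. V k \<omega>) n)) \<in> measurable M (count_space UNIV)"
proof -
  define H where "H m \<omega> = map (\<lambda>k. V k \<omega>) [1..<Suc m]" for m \<omega>
  have H: "H m \<in> measurable M (count_space UNIV)" for m
  proof (induction m)
    case (Suc m)
    have "(\<lambda>\<omega>. (V (Suc m) \<omega>, H m \<omega>)) \<in> measurable M (count_space UNIV \<Otimes>\<^sub>M count_space UNIV)"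
      using Suc measurable_V by (intro measurable_Pair) auto
    then have "(\<lambda>\<omega>. (V (Suc m) \<omega>, H m \<omega>)) \<in> measurable M (count_space UNIV)"
      by (simp add: pair_measure_countable)
    then have "(\<lambda>\<omega>. (\<lambda>(v, h). h @ [v]) (V (Suc m) \<omega>, H m \<omega>)) \<in> measurable M (count_space UNIV)"
      by (rule measurable_compose) simp
    then show ?case by (simp add: H_def)
  qed (simp add: H_def)
  have "tree_metric (\<lambda>k. V k \<omega>) n = tree_metric (\<lambda>k. H n \<omega> ! (k - 1)) n" for \<omega>
    unfolding tree_metric_def
    by (subst tree_edges_cong[of n "\<lambda>k. V k \<omega>" "\<lambda>k. H n \<omega> ! (k - 1)"])
       (auto simp: H_def nth_append simp del: upt_Suc)
  then show ?thesis
    using measurable_compose[OF H, of "\<lambda>h. F (tree_metric (\<lambda>k. h ! (k - 1)) n)" "count_space UNIV" n]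
    by simp
qed

end

end

theory Submission
  imports Defs "HOL-Real_Asymp.Real_Asymp"
begin

text \<open>The rescaled tree looks like a segment for two reasons.

  \<^emph>\<open>The depth of a vertex is almost a function of its label.\<close> The parent of \<open>n + 1\<close> is uniform on the
  \<open>\<lfloor>n\<^sup>\<beta>\<rfloor> + 1\<close> most recent vertices, so near the label \<open>x\<close> an ancestral line descends by about
  \<open>x\<^sup>\<beta> / 2\<close> per generation. The depth of \<open>x\<close> should therefore be close to the integral of
  \<open>2 t powr - \<beta>\<close> over \<open>[0, x]\<close>, which is \<open>mean_depth \<beta> x = 2 / (1 - \<beta>) * x powr (1 - \<beta>)\<close>. A Chernoff
  argument makes this uniform in the vertex: multiplying \<open>mean_depth\<close> by \<open>1 \<plusminus> \<epsilon>\<close> creates a drift of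
  order \<open>\<epsilon>\<close> per generation, which beats the second-order term of the exponential when the exponent is
  small, and so the exponential moments in \<open>depth_exp_moment\<close> are bounded over all vertices. The
  resulting tail \<open>exp (- const * n powr (1 - \<beta>))\<close> leaves room for a union bound over all vertices.

  \<^emph>\<open>Ancestral lines merge quickly.\<close> Follow two lines back in time, always moving the one with the
  larger label to its parent. Once the smaller label lies in the window from which the larger one
  draws its parent, this remains so after every later step, because the lower end \<open>j\<close> of the window
  is monotone; and then each step merges the lines with probability at least \<open>1 / (n\<^sup>\<beta> + 1)\<close>. The number
  of such steps has a geometric tail on the scale \<open>n\<^sup>\<beta>\<close> (\<open>merge_steps_tail\<close>), so for all pairs of vertices at
  once it is at most \<open>\<eta> * n powr (1 - \<beta>)\<close>; this is where \<open>\<beta> < 1 / 2\<close> enters. Up to twice this number, the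
  distance of two vertices is the difference of their depths (\<open>d_le_depth_diff_merge_steps\<close>).

  Together, with high probability \<open>v \<mapsto> (v / n) powr (1 - \<beta>)\<close> distorts the rescaled tree metric only
  slightly as a map to \<open>[0, 1]\<close>. Its image has gaps of at most \<open>n powr - (1 - \<beta>)\<close>, and
  \<open>GH_dist_le_of_approx_isometry\<close> bounds the Gromov--Hausdorff distance.\<close>

section \<open>Approximate isometries and the Gromov--Hausdorff distance\<close>

lemma GH_dist_le_hausdorff_dist:
  fixes X :: "'a metric" and Y :: "'b metric" and Z :: "('a + 'b) metric"
  assumes "isometric_embedding X Z f" "isometric_embedding Y Z g"
    and r: "0 < r" "f ` mspace X \<subseteq> (\<Union>b\<in>g ` mspace Y. mball_of Z b r)"
      "g ` mspace Y \<subseteq> (\<Union>a\<in>f ` mspace X. mball_of Z a r)"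
  shows "GH_dist X Y \<le> r"
proof -
  let ?H = "{hausdorff_dist Z (f ` mspace X) (g ` mspace Y) | (Z :: ('a + 'b) metric) f g.
    isometric_embedding X Z f \<and> isometric_embedding Y Z g}"
  \<comment> \<open>Where no radius is admissible, \<open>hausdorff_dist\<close> is the arbitrary number \<open>Inf {}\<close>, which may be
    negative: it has to be taken into the lower bound.\<close>
  have "min 0 (Inf {}) \<le> hausdorff_dist W A B" for W :: "('a + 'b) metric" and A B
  proof (cases "{r. r > 0 \<and> A \<subseteq> (\<Union>b\<in>B. mball_of W b r) \<and> B \<subseteq> (\<Union>a\<in>A. mball_of W a r)} = {}")
    case True
    show ?thesis unfolding hausdorff_dist_def True by simp
  next
    case False
    then have "0 \<le> hausdorff_dist W A B"
      unfolding hausdorff_dist_def by (intro cInf_greatest) auto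
    then show ?thesis by simp
  qed
  then have "bdd_below ?H" by (intro bdd_belowI[of _ "min 0 (Inf {})"]) blast
  then have "GH_dist X Y \<le> hausdorff_dist Z (f ` mspace X) (g ` mspace Y)"
    unfolding GH_dist_def using assms(1,2) by (intro cInf_lower) blast+
  also have "\<dots> \<le> r"
    unfolding hausdorff_dist_def using r by (intro cInf_lower bdd_belowI[of _ 0]) auto
  finally show ?thesis .
qed

lemma mdist_self: "x \<in> mspace X \<Longrightarrow> mdist X x x = 0"
  by simp

text \<open>The two spaces are glued along the graph of \<open>t\<close>: going from \<open>x\<close> to \<open>y\<close> means to walk to some \<open>x'\<close>,
  to cross over to \<open>t x'\<close> at the price \<open>\<delta>\<close>, and to walk on to \<open>y\<close>. Crossing back and forth costs
  \<open>2 * \<delta>\<close>, which pays for the distortion; this is why the glued distance extends both metrics.\<close>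

lemma GH_dist_le_of_approx_isometry:
  fixes X :: "'a metric" and Y :: "'b metric"
  assumes ne: "mspace X \<noteq> {}" and \<delta>: "0 < \<delta>"
    and t: "\<And>x. x \<in> mspace X \<Longrightarrow> t x \<in> mspace Y"
    and dist: "\<And>x x'. x \<in> mspace X \<Longrightarrow> x' \<in> mspace X \<Longrightarrow>
      \<bar>mdist X x x' - mdist Y (t x) (t x')\<bar> \<le> 2 * \<delta>"
    and dense: "\<And>y. y \<in> mspace Y \<Longrightarrow> \<exists>x\<in>mspace X. mdist Y (t x) y \<le> \<delta>'"
    and r: "\<delta> + \<delta>' < r"
  shows "GH_dist X Y \<le> r"
proof -
  define \<rho> where "\<rho> x y = (INF x'\<in>mspace X. mdist X x x' + \<delta> + mdist Y (t x') y)" for x y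
  have bdd: "bdd_below ((\<lambda>x'. mdist X x x' + \<delta> + mdist Y (t x') y) ` mspace X)" for x y
    by (rule bdd_belowI[of _ 0]) (use \<delta> in \<open>auto\<close>)
  have \<rho>_le: "\<rho> x y \<le> mdist X x x' + \<delta> + mdist Y (t x') y" if "x' \<in> mspace X" for x y x'
    unfolding \<rho>_def using bdd that by (rule cINF_lower)
  have le_\<rho>: "c \<le> \<rho> x y" if "\<And>x'. x' \<in> mspace X \<Longrightarrow> c \<le> mdist X x x' + \<delta> + mdist Y (t x') y" for c x y
    unfolding \<rho>_def using ne that by (rule cINF_greatest)
  have \<rho>_pos: "\<rho> x y \<ge> \<delta>" for x y by (rule le_\<rho>) simp
  define D where "D p q = (case p of
      Inl x \<Rightarrow> (case q of Inl x' \<Rightarrow> mdist X x x' | Inr y \<Rightarrow> \<rho> x y)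
    | Inr y \<Rightarrow> (case q of Inl x' \<Rightarrow> \<rho> x' y | Inr y' \<Rightarrow> mdist Y y y'))" for p q
  \<comment> \<open>In \<open>tri3\<close> and \<open>tri4\<close> the path leaves a space and returns to it: here the bound on the
    distortion enters.\<close>
  have tri1: "\<rho> x y \<le> mdist X x x2 + \<rho> x2 y" if "x \<in> mspace X" "x2 \<in> mspace X" "y \<in> mspace Y" for x x2 y
  proof -
    have "\<rho> x y - mdist X x x2 \<le> \<rho> x2 y"
    proof (rule le_\<rho>)
      fix x' assume "x' \<in> mspace X"
      then show "\<rho> x y - mdist X x x2 \<le> mdist X x2 x' + \<delta> + mdist Y (t x') y"
        using \<rho>_le[of x' x y] mdist_triangle[of x X x2 x'] that by simp
    qed
    then show ?thesis by simp
  qed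
  have tri2: "\<rho> x y \<le> \<rho> x y2 + mdist Y y2 y" if "x \<in> mspace X" "y \<in> mspace Y" "y2 \<in> mspace Y" for x y2 y
  proof -
    have "\<rho> x y - mdist Y y2 y \<le> \<rho> x y2"
    proof (rule le_\<rho>)
      fix x' assume "x' \<in> mspace X"
      then show "\<rho> x y - mdist Y y2 y \<le> mdist X x x' + \<delta> + mdist Y (t x') y2"
        using \<rho>_le[of x' x y] mdist_triangle[of "t x'" Y y2 y] that t by auto
    qed
    then show ?thesis by simp
  qed
  have tri3: "mdist X x x2 \<le> \<rho> x y + \<rho> x2 y" if "x \<in> mspace X" "x2 \<in> mspace X" "y \<in> mspace Y" for x x2 y
  proof -
    have "mdist X x x2 - \<rho> x2 y \<le> \<rho> x y"
    proof (rule le_\<rho>)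
      fix x' assume x': "x' \<in> mspace X"
      have "mdist X x x2 - (mdist X x x' + \<delta> + mdist Y (t x') y) \<le> \<rho> x2 y"
      proof (rule le_\<rho>)
        fix x'' assume x'': "x'' \<in> mspace X"
        have "mdist X x x2 \<le> mdist X x x' + (mdist X x' x'' + mdist X x'' x2)"
          using mdist_triangle[of x X x' x2] mdist_triangle[of x' X x'' x2] that x' x'' by simp
        moreover have "mdist X x' x'' \<le> mdist Y (t x') (t x'') + 2 * \<delta>"
          using dist[OF x' x''] by simp
        moreover have "mdist Y (t x') (t x'') \<le> mdist Y (t x') y + mdist Y (t x'') y"
          using mdist_triangle[of "t x'" Y y "t x''"] mdist_commute[of Y y] t that x' x'' by auto
        ultimately show "mdist X x x2 - (mdist X x x' + \<delta> + mdist Y (t x') y)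
            \<le> mdist X x2 x'' + \<delta> + mdist Y (t x'') y"
          using mdist_commute[of X x2 x''] by simp
      qed
      then show "mdist X x x2 - \<rho> x2 y \<le> mdist X x x' + \<delta> + mdist Y (t x') y" by simp
    qed
    then show ?thesis by simp
  qed
  have tri4: "mdist Y y y2 \<le> \<rho> x y + \<rho> x y2" if "x \<in> mspace X" "y2 \<in> mspace Y" "y \<in> mspace Y" for x y2 y
  proof -
    have "mdist Y y y2 - \<rho> x y2 \<le> \<rho> x y"
    proof (rule le_\<rho>)
      fix x' assume x': "x' \<in> mspace X"
      have "mdist Y y y2 - (mdist X x x' + \<delta> + mdist Y (t x') y) \<le> \<rho> x y2"
      proof (rule le_\<rho>)
        fix x'' assume x'': "x'' \<in> mspace X"
        have "mdist Y y y2 \<le> mdist Y y (t x') + (mdist Y (t x') (t x'') + mdist Y (t x'') y2)"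
          using mdist_triangle[of y Y "t x'" y2] mdist_triangle[of "t x'" Y "t x''" y2] that x' x'' t
          by fastforce
        moreover have "mdist Y (t x') (t x'') \<le> mdist X x' x'' + 2 * \<delta>"
          using dist[OF x' x''] by simp
        moreover have "mdist X x' x'' \<le> mdist X x x' + mdist X x x''"
          using mdist_triangle[of x' X x x''] mdist_commute[of X x'] that x' x'' by auto
        ultimately show "mdist Y y y2 - (mdist X x x' + \<delta> + mdist Y (t x') y)
            \<le> mdist X x x'' + \<delta> + mdist Y (t x'') y2"
          using mdist_commute[of Y y "t x'"] by simp
      qed
      then show "mdist Y y y2 - \<rho> x y2 \<le> mdist X x x' + \<delta> + mdist Y (t x') y" by simp
    qed
    then show ?thesis by simp
  qed
  have tri1': "\<rho> x y \<le> \<rho> x2 y + mdist X x2 x" if "x \<in> mspace X" "x2 \<in> mspace X" "y \<in> mspace Y" for x x2 y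
    using tri1[OF that] mdist_commute[of X x] by simp
  have tri2': "\<rho> x y \<le> mdist Y y y2 + \<rho> x y2" if "x \<in> mspace X" "y \<in> mspace Y" "y2 \<in> mspace Y" for x y2 y
    using tri2[OF that] mdist_commute[of Y y] by simp
  interpret Z: Metric_space "mspace X <+> mspace Y" D
  proof
    show "0 \<le> D p q" for p q
      using \<rho>_pos \<delta> by (auto simp: D_def split: sum.splits intro: order_trans[of 0 \<delta>])
    show "D p q = D q p" for p q
      by (auto simp: D_def mdist_commute split: sum.splits)
    show "D p q = 0 \<longleftrightarrow> p = q" if "p \<in> mspace X <+> mspace Y" "q \<in> mspace X <+> mspace Y" for p q
      using that \<rho>_pos \<delta> by (auto simp: D_def split: sum.splits) (smt (verit))+
    show "D p s \<le> D p q + D q s" if "p \<in> mspace X <+> mspace Y" "q \<in> mspace X <+> mspace Y"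
      "s \<in> mspace X <+> mspace Y" for p q s
      apply (insert that, elim PlusE)
             apply (simp_all only: D_def sum.case)
      by (rule tri1 tri2 tri1' tri2' tri3 tri4 mdist_triangle; assumption)+
  qed
  let ?Z = "metric (mspace X <+> mspace Y, D)"
  have \<delta>': "0 \<le> \<delta>'"
  proof -
    obtain x where "x \<in> mspace X" using ne by blast
    then have "t x \<in> mspace Y" using t by auto
    from dense[OF this] obtain x' where "mdist Y (t x') (t x) \<le> \<delta>'" by blast
    with mdist_nonneg[of Y "t x'" "t x"] show ?thesis by linarith
  qed
  show ?thesis
  proof (rule GH_dist_le_hausdorff_dist)
    show "isometric_embedding X ?Z Inl" "isometric_embedding Y ?Z Inr"
      by (auto simp: isometric_embedding_def D_def)
    show "0 < r" using \<delta> \<delta>' r by simp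
    show "Inl ` mspace X \<subseteq> (\<Union>b\<in>Inr ` mspace Y. mball_of ?Z b r)"
    proof (rule image_subsetI)
      fix x assume x: "x \<in> mspace X"
      have "\<rho> x (t x) \<le> \<delta>"
        using \<rho>_le[OF x, of x "t x"] mdist_self[OF x] mdist_self[OF t[OF x]] by linarith
      then have "Inl x \<in> mball_of ?Z (Inr (t x)) r"
        using x t[OF x] r \<delta>' by (simp add: InlI InrI D_def del: Z.mball_of)
      then show "Inl x \<in> (\<Union>b\<in>Inr ` mspace Y. mball_of ?Z b r)" using t[OF x] by blast
    qed
    show "Inr ` mspace Y \<subseteq> (\<Union>a\<in>Inl ` mspace X. mball_of ?Z a r)"
    proof (rule image_subsetI)
      fix y assume y: "y \<in> mspace Y"
      then obtain x where x: "x \<in> mspace X" "mdist Y (t x) y \<le> \<delta>'" using dense by blast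
      then have "\<rho> x y \<le> \<delta> + \<delta>'" using \<rho>_le[of x x y] mdist_self[OF x(1)] by linarith
      then have "Inr y \<in> mball_of ?Z (Inl x) r"
        using x y r by (simp add: InlI InrI D_def del: Z.mball_of)
      then show "Inr y \<in> (\<Union>a\<in>Inl ` mspace X. mball_of ?Z a r)" using x by blast
    qed
  qed
qed

lemma scale_metric_simps:
  assumes "0 < c"
  shows "mspace (scale_metric c X) = mspace X" "mdist (scale_metric c X) = (\<lambda>x y. c * mdist X x y)"
proof -
  interpret Metric_space "mspace X" "\<lambda>x y. c * mdist X x y"
  proof
    show "c * mdist X x z \<le> c * mdist X x y + c * mdist X y z"
      if "x \<in> mspace X" "y \<in> mspace X" "z \<in> mspace X" for x y z
      using mdist_triangle[OF that] assms by (simp flip: distrib_left)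
  qed (use assms in \<open>auto simp: mdist_commute\<close>)
  show "mspace (scale_metric c X) = mspace X" "mdist (scale_metric c X) = (\<lambda>x y. c * mdist X x y)"
    by (simp_all add: scale_metric_def)
qed

section \<open>Depth and distance in a recursive tree\<close>

text \<open>The minimum makes ancestral lines descend for every sequence \<open>p\<close>, also off the almost sure event that
  all choices are admissible, so that \<open>depth\<close> and \<open>merge_steps\<close> are total functions of the choices and
  can be inserted into expectations.\<close>

definition parent :: "(nat \<Rightarrow> nat) \<Rightarrow> nat \<Rightarrow> nat" where
  "parent p a = min (p (a - 1)) (a - 1)"

lemma parent_less: "0 < a \<Longrightarrow> parent p a < a"
  by (auto simp: parent_def)

function depth :: "(nat \<Rightarrow> nat) \<Rightarrow> nat \<Rightarrow> nat" where
  "depth p a = (if a \<le> 1 then 0 else Suc (depth p (parent p a)))"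
  by auto
termination by (relation "Wellfounded.measure snd") (auto intro: parent_less)

text \<open>The lines of \<open>a \<ge> b\<close> are followed until they merge, always moving the larger label. The counter runs
  only on the steps at which \<open>b\<close> is an admissible parent of \<open>a\<close>. Without the clause for \<open>b = 0\<close>, which is
  not a vertex, the recursion could reach the meaningless choice \<open>p 0\<close>.\<close>

function merge_steps :: "(nat \<Rightarrow> int) \<Rightarrow> (nat \<Rightarrow> nat) \<Rightarrow> nat \<Rightarrow> nat \<Rightarrow> nat" where
  "merge_steps j p a b = (if a \<le> b \<or> b = 0 then 0
     else (if j (a - 1) \<le> int b then 1 else 0) + merge_steps j p (max (parent p a) b) (min (parent p a) b))"
  by auto
termination by (relation "Wellfounded.measure (\<lambda>(j, p, a, b). a)") (auto intro: parent_less)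

declare depth.simps[simp del] merge_steps.simps[simp del]

lemma depth_Suc: "0 < m \<Longrightarrow> depth p (Suc m) = Suc (depth p (min (p m) m))"
  by (subst depth.simps) (simp add: parent_def)

lemma depth_le: "depth p a \<le> a"
proof (induction a rule: less_induct)
  case (less a)
  then show ?case
    by (cases "a \<le> 1"; subst depth.simps; use less[of "parent p a"] parent_less[of a p] in force)
qed

lemma depth_cong: "(\<And>k. k \<in> {1..<a} \<Longrightarrow> p k = q k) \<Longrightarrow> depth p a = depth q a"
proof (induction a rule: less_induct)
  case (less a)
  show ?case
  proof (cases "a \<le> 1")
    case True then show ?thesis by (simp add: depth.simps)
  next
    case False
    then have "parent p a = parent q a" using less.prems[of "a - 1"] by (simp add: parent_def)
    moreover have "depth p (parent q a) = depth q (parent q a)"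
      using less False parent_less[of a q] by auto
    ultimately show ?thesis by (subst (1 2) depth.simps) simp
  qed
qed

lemma merge_steps_cong: "(\<And>k. k \<in> {1..<a} \<Longrightarrow> p k = q k) \<Longrightarrow> merge_steps j p a b = merge_steps j q a b"
proof (induction a arbitrary: b rule: less_induct)
  case (less a)
  show ?case
  proof (cases "a \<le> b \<or> b = 0")
    case True then show ?thesis by (simp add: merge_steps.simps)
  next
    case False
    then have par: "parent p a = parent q a" using less.prems[of "a - 1"] by (simp add: parent_def Suc_le_eq)
    have "merge_steps j p (max (parent q a) b) (min (parent q a) b) = merge_steps j q (max (parent q a) b) (min (parent q a) b)"
      using less.prems False parent_less[of a q] by (intro less.IH) auto
    then show ?thesis using par by (subst (1 2) merge_steps.simps) simp
  qed
qed

lemma mem_tree_edges_iff: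
  "(u, v) \<in> tree_edges p n \<longleftrightarrow> (\<exists>k\<in>{1..<n}. (u, v) = (Suc k, p k) \<or> (u, v) = (p k, Suc k))"
  by (induction p n rule: tree_edges.induct) (auto simp: less_Suc_eq)

locale rooted_tree =
  fixes p :: "nat \<Rightarrow> nat" and n :: nat
  assumes p: "\<And>k. k \<in> {1..<n} \<Longrightarrow> p k \<in> {1..k}"
begin

abbreviation d :: "nat \<Rightarrow> nat \<Rightarrow> nat" where "d \<equiv> graph_dist (tree_edges p n)"

lemma pred_mem: "a \<in> {2..n} \<Longrightarrow> a - 1 \<in> {1..<n}"
  by auto

lemma parent_eq: "a \<in> {2..n} \<Longrightarrow> parent p a = p (a - 1)"
  using p[OF pred_mem] by (simp add: parent_def)

lemma parent_mem: "a \<in> {2..n} \<Longrightarrow> parent p a \<in> {1..<a}"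
  using p[OF pred_mem] parent_eq[of a] by fastforce

sublocale Metric_space "{1..n}" "\<lambda>u v. real (d u v)"
  using p by (rule Metric_space_tree)

lemma d_triangle: "u \<in> {1..n} \<Longrightarrow> v \<in> {1..n} \<Longrightarrow> w \<in> {1..n} \<Longrightarrow> d u w \<le> d u v + d v w"
  using triangle[of u v w] by linarith

lemma d_self: "d u u = 0"
  by (simp add: graph_dist_def)

lemma d_commute: "d u v = d v u"
  using commute[of u v] by simp

lemma d_parent: "a \<in> {2..n} \<Longrightarrow> d a (parent p a) \<le> 1"
  unfolding graph_dist_def using parent_eq[of a]
  by (intro Least_le) (auto simp: mem_tree_edges_iff intro!: bexI[of _ "a - 1"])

lemma depth_parent: "a \<in> {2..n} \<Longrightarrow> depth p a = Suc (depth p (parent p a))"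
  by (simp add: depth.simps[of p a])

lemma walk_exists:
  assumes "u \<in> {1..n}" "v \<in> {1..n}"
  shows "(u, v) \<in> tree_edges p n ^^ d u v"
proof -
  have "(u, 1) \<in> (tree_edges p n)\<^sup>*" "(v, 1) \<in> (tree_edges p n)\<^sup>*"
    using tree_edges_connected p assms by blast+
  then have "(u, v) \<in> (tree_edges p n)\<^sup>*"
    by (meson rtrancl_trans sym_rtrancl symD tree_edges_sym)
  then show ?thesis
    unfolding graph_dist_def by (metis LeastI_ex rtrancl_imp_relpow)
qed

lemma depth_edge:
  assumes "(u, v) \<in> tree_edges p n"
  shows "\<bar>int (depth p u) - int (depth p v)\<bar> \<le> 1"
proof -
  obtain k where k: "k \<in> {1..<n}" "(u, v) = (Suc k, p k) \<or> (u, v) = (p k, Suc k)"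
    using assms mem_tree_edges_iff by blast
  have "depth p (Suc k) = Suc (depth p (p k))"
    using depth_parent[of "Suc k"] parent_eq[of "Suc k"] k(1) by auto
  then show ?thesis using k(2) by auto
qed

lemma depth_diff_le_d:
  assumes "u \<in> {1..n}" "v \<in> {1..n}"
  shows "\<bar>int (depth p u) - int (depth p v)\<bar> \<le> int (d u v)"
proof -
  have "\<bar>int (depth p u) - int (depth p v)\<bar> \<le> int k" if "(u, v) \<in> tree_edges p n ^^ k" for k
    using that
  proof (induction k arbitrary: v)
    case (Suc k)
    then obtain w where "(u, w) \<in> tree_edges p n ^^ k" "(w, v) \<in> tree_edges p n" by auto
    with Suc.IH[of w] depth_edge[of w v] show ?case by linarith
  qed simp
  then show ?thesis using walk_exists[OF assms] by blast
qed

end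

locale limited_tree = rooted_tree +
  fixes j :: "nat \<Rightarrow> int"
  assumes mono_j: "mono j"
    and window: "\<And>k. k \<in> {1..<n} \<Longrightarrow> j k \<le> int (p k)"
begin

lemma window_parent: "a \<in> {2..n} \<Longrightarrow> j (a - 1) \<le> int (parent p a)"
  using window[OF pred_mem] parent_eq[of a] by simp

text \<open>Once \<open>b\<close> is an admissible parent of \<open>a\<close>, every step counts: the new pair consists of \<open>b\<close> and another
  member of the window of \<open>a\<close>, and by monotonicity the window of the larger of the two starts no later.
  So the counter is the length of a walk from \<open>a\<close> to \<open>b\<close>.\<close>

lemma d_le_merge_steps:
  assumes "1 \<le> b" "b \<le> a" "a \<le> n" "j (a - 1) \<le> int b"
  shows "d a b \<le> merge_steps j p a b"
  using assms
proof (induction a arbitrary: b rule: less_induct)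
  case (less a)
  show ?case
  proof (cases "a = b")
    case True
    then show ?thesis by (simp add: d_self)
  next
    case False
    let ?a = "parent p a"
    have a: "a \<in> {2..n}" using less.prems False by auto
    have pa: "?a \<in> {1..<a}" using parent_mem a by blast
    have win: "j (a - 1) \<le> int ?a" using window_parent[OF a] .
    have mono: "j (k - 1) \<le> j (a - 1)" if "k < a" for k
      using that by (intro monoD[OF mono_j]) auto
    have "d (max ?a b) (min ?a b) \<le> merge_steps j p (max ?a b) (min ?a b)"
    proof (rule less.IH)
      show "max ?a b < a" "1 \<le> min ?a b" "min ?a b \<le> max ?a b" "max ?a b \<le> n"
        using pa less.prems False by auto
      have "j (max ?a b - 1) \<le> j (a - 1)" using pa less.prems False by (intro mono) auto
      then show "j (max ?a b - 1) \<le> int (min ?a b)" using win less.prems(4) by auto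
    qed
    moreover have "d (max ?a b) (min ?a b) = d ?a b"
      by (metis d_commute max_def min_def)
    moreover have "d a b \<le> d a ?a + d ?a b"
      using a pa less.prems by (intro d_triangle) auto
    moreover have "merge_steps j p a b = Suc (merge_steps j p (max ?a b) (min ?a b))"
      using less.prems False by (subst merge_steps.simps) auto
    ultimately show ?thesis using d_parent[OF a] by simp
  qed
qed

text \<open>Steps before \<open>b\<close> is an admissible parent lead along the ancestral line of \<open>a\<close> and change the distance
  and the depth alike. From then on \<open>d_le_merge_steps\<close> bounds the distance, and as the depth is 1-Lipschitz,
  it also bounds the amount by which \<open>b\<close> may lie deeper than \<open>a\<close>; hence the factor 2.\<close>

lemma d_le_depth_diff_merge_steps:
  assumes "1 \<le> b" "b \<le> a" "a \<le> n"
  shows "int (d a b) \<le> int (depth p a) - int (depth p b) + 2 * int (merge_steps j p a b)"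
  using assms
proof (induction a arbitrary: b rule: less_induct)
  case (less a)
  consider "a = b" | "j (a - 1) \<le> int b" | "a \<noteq> b" "\<not> j (a - 1) \<le> int b"
    by blast
  then show ?case
  proof cases
    case 1
    then show ?thesis by (simp add: d_self)
  next
    case 2
    have "int (depth p b) - int (depth p a) \<le> int (d a b)"
      using depth_diff_le_d[of a b] less.prems by auto
    with d_le_merge_steps[OF less.prems 2] show ?thesis by linarith
  next
    case 3
    let ?a = "parent p a"
    have a: "a \<in> {2..n}" using less.prems 3 by auto
    have pa: "?a \<in> {1..<a}" using parent_mem a by blast
    have "j (a - 1) \<le> int ?a" using window_parent[OF a] .
    then have ba: "b < ?a" using 3 by auto
    have "int (d ?a b) \<le> int (depth p ?a) - int (depth p b) + 2 * int (merge_steps j p ?a b)"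
      using pa ba less.prems by (intro less.IH) auto
    moreover have "d a b \<le> d a ?a + d ?a b"
      using a pa less.prems by (intro d_triangle) auto
    moreover have "merge_steps j p a b = merge_steps j p ?a b"
      using less.prems 3 ba by (subst merge_steps.simps) auto
    ultimately show ?thesis using d_parent[OF a] depth_parent[OF a] by simp
  qed
qed

end

section \<open>Conditioning on one choice\<close>

context limited_memory_trees
begin

definition window :: "nat \<Rightarrow> nat set" where
  "window m = {v \<in> {1..m}. j m \<le> int v}"

lemma finite_window [simp]: "finite (window m)"
  by (simp add: window_def)

text \<open>Finitely many choices form a discrete random variable, so every function of them is measurable.\<close>

lemma measurable_choices:
  assumes dep: "\<And>p q. (\<And>k. k \<in> {1..<m} \<Longrightarrow> p k = q k) \<Longrightarrow> F p = F q"
  shows "(\<lambda>\<omega>. F (\<lambda>k. V k \<omega>)) \<in> measurable M (count_space UNIV)"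
proof -
  have "F (\<lambda>k. V k \<omega>) = F (restrict (\<lambda>k. V k \<omega>) {1..<m})" for \<omega>
    by (rule dep) simp
  moreover have "(\<lambda>\<omega>. restrict (\<lambda>k. V k \<omega>) {1..<m}) \<in> measurable M (PiM {1..<m} (\<lambda>_. count_space UNIV))"
    using measurable_V by (intro measurable_restrict) auto
  moreover have "F \<in> measurable (PiM {1..<m} (\<lambda>_. count_space UNIV)) (count_space UNIV)"
    by (subst count_space_PiM_finite) auto
  ultimately show ?thesis
    using measurable_compose by force
qed

lemma sets_choices:
  assumes "\<And>p q. (\<And>k. k \<in> {1..<m} \<Longrightarrow> p k = q k) \<Longrightarrow> F p = F q"
  shows "{\<omega> \<in> space M. R (F (\<lambda>k. V k \<omega>))} \<in> sets M"
  using measurable_sets[OF measurable_choices[of m F, OF assms], of "Collect R"]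
  by (simp add: vimage_def Int_def conj_commute)

lemma
  assumes m: "1 \<le> m" "j m \<le> int m"
  shows distr_choice: "distr M (count_space UNIV) (V m) = measure_pmf (pmf_of_set (window m))"
    and window_nonempty: "window m \<noteq> {}"
    and AE_choice: "AE \<omega> in M. V m \<omega> \<in> window m"
proof -
  show ne: "window m \<noteq> {}" using m by (auto simp: window_def)
  show dist: "distr M (count_space UNIV) (V m) = measure_pmf (pmf_of_set (window m))"
    using uniform_choice[OF m(1)] by (simp add: window_def)
  have "AE v in measure_pmf (pmf_of_set (window m)). v \<in> window m"
    using ne by (simp add: AE_measure_pmf_iff)
  then show "AE \<omega> in M. V m \<omega> \<in> window m"
    unfolding dist[symmetric] using measurable_V[OF m(1)] by (subst (asm) AE_distr_iff) auto
qed

text \<open>The strong form of independence of the past: the latest choice can be averaged out while the earlier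
  ones stay random. Iterating it along ancestral lines gives the estimates for the depth and for the merging.\<close>

lemma expectation_choice:
  fixes g :: "nat \<Rightarrow> (nat \<Rightarrow> nat) \<Rightarrow> real"
  assumes m: "1 \<le> m" "j m \<le> int m"
    and dep: "\<And>v p q. (\<And>k. k \<in> {1..<m} \<Longrightarrow> p k = q k) \<Longrightarrow> g v p = g v q"
    and bounded: "\<And>v p. \<bar>g v p\<bar> \<le> B"
  shows "expectation (\<lambda>\<omega>. g (V m \<omega>) (\<lambda>k. V k \<omega>)) =
    (\<Sum>v\<in>window m. expectation (\<lambda>\<omega>. g v (\<lambda>k. V k \<omega>))) / card (window m)"
proof -
  note [measurable] = measurable_V[OF m(1)]
  note ne = window_nonempty[OF m] and dist = distr_choice[OF m] and AE = AE_choice[OF m]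
  have prob: "expectation (\<lambda>\<omega>. indicator {v} (V m \<omega>)) = 1 / card (window m)" if "v \<in> window m" for v
  proof -
    have "expectation (\<lambda>\<omega>. indicator {v} (V m \<omega>)) =
        integral\<^sup>L (distr M (count_space UNIV) (V m)) (indicator {v} :: nat \<Rightarrow> real)"
      by (subst integral_distr) auto
    also have "\<dots> = pmf (pmf_of_set (window m)) v"
      unfolding dist by (simp add: measure_pmf_single)
    finally show ?thesis using that ne by (simp add: pmf_of_set)
  qed
  have dep2: "g (p m) p = g (q m) q" if "\<And>k. k \<in> {1..<Suc m} \<Longrightarrow> p k = q k" for p q
    using dep[of p q "p m"] that m by auto
  have meas: "(\<lambda>\<omega>. g v (\<lambda>k. V k \<omega>)) \<in> borel_measurable M" for v
    using measurable_compose[OF measurable_choices[of m "g v", OF dep], of id borel] by simp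
  have int: "integrable M (\<lambda>\<omega>. g v (\<lambda>k. V k \<omega>))" for v
    by (rule integrable_const_bound[of _ B]) (use meas bounded in auto)
  have int': "integrable M (\<lambda>\<omega>. indicator {v} (V m \<omega>) :: real)" for v
    by (rule integrable_const_bound[of _ 1])
      (auto intro!: measurable_compose[OF measurable_V[OF m(1)]])
  have indep: "indep_var borel (\<lambda>\<omega>. indicator {v} (V m \<omega>) :: real) borel (\<lambda>\<omega>. g v (\<lambda>k. V k \<omega>))" for v
  proof -
    have "indep_var (PiM {m} (\<lambda>_. count_space UNIV)) (\<lambda>\<omega>. restrict (\<lambda>k. V k \<omega>) {m})
        (PiM {1..<m} (\<lambda>_. count_space UNIV)) (\<lambda>\<omega>. restrict (\<lambda>k. V k \<omega>) {1..<m})"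
      using indep_choices m by (rule_tac indep_var_restrict) auto
    then have "indep_var borel ((\<lambda>p. indicator {v} (p m) :: real) \<circ> (\<lambda>\<omega>. restrict (\<lambda>k. V k \<omega>) {m}))
        borel (g v \<circ> (\<lambda>\<omega>. restrict (\<lambda>k. V k \<omega>) {1..<m}))"
      by (rule indep_var_compose) (simp_all add: count_space_PiM_finite)
    moreover have "g v (restrict (\<lambda>k. V k \<omega>) {1..<m}) = g v (\<lambda>k. V k \<omega>)" for \<omega>
      by (rule dep) simp
    ultimately show ?thesis by (simp add: comp_def)
  qed
  have "expectation (\<lambda>\<omega>. g (V m \<omega>) (\<lambda>k. V k \<omega>)) =
      expectation (\<lambda>\<omega>. \<Sum>v\<in>window m. indicator {v} (V m \<omega>) * g v (\<lambda>k. V k \<omega>))"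
  proof (rule integral_cong_AE)
    show "(\<lambda>\<omega>. g (V m \<omega>) (\<lambda>k. V k \<omega>)) \<in> borel_measurable M"
      using measurable_compose[OF measurable_choices[of "Suc m" "\<lambda>p. g (p m) p", OF dep2], of id borel]
      by simp
    show "(\<lambda>\<omega>. \<Sum>v\<in>window m. indicator {v} (V m \<omega>) * g v (\<lambda>k. V k \<omega>)) \<in> borel_measurable M"
      using int int' by (intro borel_measurable_sum borel_measurable_times borel_measurable_integrable)
    show "AE \<omega> in M. g (V m \<omega>) (\<lambda>k. V k \<omega>) = (\<Sum>v\<in>window m. indicator {v} (V m \<omega>) * g v (\<lambda>k. V k \<omega>))"
      using AE
    proof eventually_elim
      case (elim \<omega>)
      then show ?case
        by (subst sum.remove[of _ "V m \<omega>"]) (auto intro!: sum.neutral)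
    qed
  qed
  also have "\<dots> = (\<Sum>v\<in>window m. expectation (\<lambda>\<omega>. indicator {v} (V m \<omega>) * g v (\<lambda>k. V k \<omega>)))"
    using int int' indep by (intro Bochner_Integration.integral_sum indep_var_integrable)
  also have "\<dots> = (\<Sum>v\<in>window m. expectation (\<lambda>\<omega>. g v (\<lambda>k. V k \<omega>)) / card (window m))"
    using int int' indep prob by (intro sum.cong refl) (simp add: indep_var_lebesgue_integral)
  finally show ?thesis by (simp add: sum_divide_distrib)
qed

text \<open>Averaging over the parent of \<open>a\<close> reduces the claim to smaller pairs. At a counted step \<open>b\<close> itself is
  one of at most \<open>q\<close> equally likely parents, and this outcome ends the process.\<close>

lemma merge_steps_tail:
  assumes q: "\<And>m. m \<in> {1..<N} \<Longrightarrow> card (window m) \<le> q" and j: "\<And>m. j m \<le> int m"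
    and ba: "1 \<le> b" "b \<le> a" "a \<le> N"
  shows "prob {\<omega> \<in> space M. k < merge_steps j (\<lambda>i. V i \<omega>) a b} \<le> (1 - 1 / real q) ^ k"
  using ba
proof (induction a arbitrary: b k rule: less_induct)
  case (less a)
  define T where "T a b k p = (of_bool (k < merge_steps j p a b) :: real)" for a b k and p :: "nat \<Rightarrow> nat"
  have T: "expectation (\<lambda>\<omega>. T a b k (\<lambda>i. V i \<omega>)) = prob {\<omega> \<in> space M. k < merge_steps j (\<lambda>i. V i \<omega>) a b}" for a b k
  proof -
    have "expectation (\<lambda>\<omega>. T a b k (\<lambda>i. V i \<omega>)) =
        expectation (indicator {\<omega> \<in> space M. k < merge_steps j (\<lambda>i. V i \<omega>) a b})"
      by (intro Bochner_Integration.integral_cong) (auto simp: T_def)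
    also have "\<dots> = prob ({\<omega> \<in> space M. k < merge_steps j (\<lambda>i. V i \<omega>) a b} \<inter> space M)"
      by (rule Bochner_Integration.integral_indicator)
    finally show ?thesis by (simp add: Int_absorb2)
  qed
  show ?case
  proof (cases "a = b")
    case True
    have "0 \<le> 1 - 1 / real q" by (cases "q = 0") auto
    with True show ?thesis by (simp add: merge_steps.simps)
  next
    case False
    define m where "m = a - 1"
    have m: "1 \<le> m" "m < N" "a = Suc m" "b \<le> m" using less.prems False by (auto simp: m_def)
    define w where "w = card (window m)"
    have "m \<in> window m" using m j by (simp add: window_def)
    then have w: "0 < w" "w \<le> q" using q[of m] m by (auto simp: w_def card_gt_0_iff)
    define t where "t = (1 - 1 / real q)"
    have t: "0 \<le> t" "t \<le> 1" "1 - 1 / real w \<le> t" using w by (auto simp: t_def frac_le)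
    define i :: nat where "i = (if j m \<le> int b then 1 else 0)"
    have step: "merge_steps j p a b = i + merge_steps j p (max (min (p m) m) b) (min (min (p m) m) b)" for p
      using less.prems m by (subst merge_steps.simps) (auto simp: parent_def i_def)
    have pw: "v \<in> {1..m}" if "v \<in> window m" for v using that by (simp add: window_def)
    let ?E = "\<lambda>v k. expectation (\<lambda>\<omega>. T (max v b) (min v b) k (\<lambda>i. V i \<omega>))"
    have IH: "?E v k \<le> t ^ k" if "v \<in> window m" for v k
      unfolding T t_def using less.prems pw[OF that] m by (intro less.IH) auto
    show ?thesis
    proof (cases "k < i")
      case True
      then have "k = 0" by (simp add: i_def split: if_splits)
      then show ?thesis by simp
    next
      case ki: False
      have "prob {\<omega> \<in> space M. k < merge_steps j (\<lambda>i. V i \<omega>) a b} =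
          expectation (\<lambda>\<omega>. (\<lambda>v. T (max (min v m) b) (min (min v m) b) (k - i)) (V m \<omega>) (\<lambda>i. V i \<omega>))"
        unfolding T[symmetric] using ki by (simp add: T_def step less_diff_conv2 add.commute)
      also have "\<dots> = (\<Sum>v\<in>window m. expectation (\<lambda>\<omega>. T (max (min v m) b) (min (min v m) b) (k - i) (\<lambda>i. V i \<omega>))) / w"
        unfolding w_def
      proof (rule expectation_choice[where B = 1])
        show "T (max (min v m) b) (min (min v m) b) (k - i) p = T (max (min v m) b) (min (min v m) b) (k - i) p'"
          if "\<And>i. i \<in> {1..<m} \<Longrightarrow> p i = p' i" for v p p'
          unfolding T_def using that m by (subst merge_steps_cong[of _ p p']) auto
      qed (use m j in \<open>auto simp: T_def\<close>)
      also have "\<dots> = (\<Sum>v\<in>window m. ?E v (k - i)) / w"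
        using pw by (intro arg_cong2[where f = "(/)"] sum.cong refl) (simp add: min_absorb1)
      also have "\<dots> \<le> t ^ k"
      proof (cases "j m \<le> int b")
        case False
        then have "(\<Sum>v\<in>window m. ?E v (k - i)) \<le> real w * t ^ k"
          using IH unfolding w_def by (intro sum_bounded_above) (auto simp: i_def)
        then show ?thesis using w by (simp add: field_simps)
      next
        case True
        then have b: "b \<in> window m" using less.prems m by (simp add: window_def)
        have "?E b (k - i) = 0" by (simp add: T_def merge_steps.simps)
        then have "(\<Sum>v\<in>window m. ?E v (k - i)) = (\<Sum>v\<in>window m - {b}. ?E v (k - i))"
          using b by (subst sum.remove[of _ b]) auto
        also have "\<dots> \<le> real (card (window m - {b})) * t ^ (k - i)"
          using IH by (intro sum_bounded_above) auto
        also have "\<dots> = (real w - 1) * t ^ (k - i)"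
          using b w by (simp add: w_def of_nat_diff)
        finally have "(\<Sum>v\<in>window m. ?E v (k - i)) / w \<le> (1 - 1 / w) * t ^ (k - i)"
          using w by (simp add: field_simps)
        also have "\<dots> \<le> t * t ^ (k - i)" using t by (intro mult_right_mono) auto
        also have "\<dots> = t ^ k" using ki True by (cases k) (auto simp: i_def)
        finally show ?thesis .
      qed
      finally show ?thesis by (simp add: t_def)
    qed
  qed
qed

end

section \<open>The depth profile and its map to the unit segment\<close>

lemma powr_add_one_le:
  fixes x a :: real
  assumes "0 \<le> x" "0 < a" "a < 1"
  shows "(x + 1) powr a \<le> x powr a + 1"
proof (cases "x = 0")
  case False
  then have x: "0 < x" using assms by simp
  have eq: "y powr a = y * y powr (a - 1)" if "0 < y" for y
    using that by (simp add: powr_diff)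
  have "(x + 1) powr a = x * (x + 1) powr (a - 1) + (x + 1) powr (a - 1)"
    using x by (subst eq) (auto simp: algebra_simps)
  also have "\<dots> \<le> x * x powr (a - 1) + 1 powr (a - 1)"
    using x assms by (intro add_mono mult_left_mono powr_mono2') auto
  finally show ?thesis using x by (simp add: eq)
qed (use assms in simp)

text \<open>The integral of \<open>2 * t powr - \<beta>\<close> over \<open>[0, x]\<close>: the number of generations needed to descend
  from \<open>x\<close> at an average of \<open>t powr \<beta> / 2\<close> per generation.\<close>

definition mean_depth :: "real \<Rightarrow> real \<Rightarrow> real" where
  "mean_depth \<beta> x = 2 / (1 - \<beta>) * x powr (1 - \<beta>)"

lemma mean_depth_diff_bounds:
  assumes \<beta>: "0 < \<beta>" "\<beta> < 1" and xy: "0 < x" "x < y"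
  shows "2 * y powr - \<beta> * (y - x) \<le> mean_depth \<beta> y - mean_depth \<beta> x"
    and "mean_depth \<beta> y - mean_depth \<beta> x \<le> 2 * x powr - \<beta> * (y - x)"
proof -
  have deriv: "(mean_depth \<beta> has_real_derivative 2 * z powr - \<beta>) (at z)" if "x \<le> z" for z
    unfolding mean_depth_def[abs_def] using that xy \<beta> by (auto intro!: derivative_eq_intros)
  obtain z where z: "x < z" "z < y" "mean_depth \<beta> y - mean_depth \<beta> x = (y - x) * (2 * z powr - \<beta>)"
    using MVT2[OF xy(2) deriv] by blast
  have "y powr - \<beta> \<le> z powr - \<beta>" "z powr - \<beta> \<le> x powr - \<beta>"
    using z xy \<beta> by (auto intro!: powr_mono2')
  then show "2 * y powr - \<beta> * (y - x) \<le> mean_depth \<beta> y - mean_depth \<beta> x"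
    "mean_depth \<beta> y - mean_depth \<beta> x \<le> 2 * x powr - \<beta> * (y - x)"
    unfolding z(3) using xy by (simp_all add: mult.commute mult_left_mono)
qed

lemma sum_steps: "(\<Sum>v\<in>{n - w..n}. real (Suc n) - real v) = real (w + 1) * real (w + 2) / 2" if "w \<le> n"
proof -
  have "(\<Sum>v\<in>{n - w..n}. real (Suc n) - real v) = (\<Sum>i\<in>{..w}. real (Suc i))"
    by (rule sum.reindex_bij_witness[of _ "\<lambda>i. n - i" "\<lambda>v. n - v"]) (use that in \<open>auto simp: of_nat_diff\<close>)
  also have "\<dots> = real (w + 1) * real (w + 2) / 2"
    by (induction w) (auto simp: field_simps)
  finally show ?thesis .
qed

text \<open>The mean value theorem puts each increment between \<open>2 * (n + 1) powr - \<beta>\<close> and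
  \<open>2 * (n - n powr \<beta>) powr - \<beta>\<close> times \<open>n + 1 - v\<close>. On average over the window \<open>n + 1 - v\<close> equals \<open>w / 2 + 1\<close>,
  so the mean increment tends to 1, the increment of the depth in one generation, and no increment
  exceeds twice this limit by much.\<close>

lemma eventually_mean_depth_increments:
  assumes \<beta>: "0 < \<beta>" "\<beta> < 1" and \<delta>: "0 < \<delta>" "\<delta> \<le> 1 / 2"
  shows "\<forall>\<^sub>F n in sequentially. \<forall>w. w = nat \<lfloor>real n powr \<beta>\<rfloor> \<longrightarrow> w < n \<and>
    (\<forall>v\<in>{n - w..n}. 0 \<le> mean_depth \<beta> (real (Suc n)) - mean_depth \<beta> (real v) \<and> mean_depth \<beta> (real (Suc n)) - mean_depth \<beta> (real v) \<le> 3) \<and>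
    \<bar>(\<Sum>v\<in>{n - w..n}. mean_depth \<beta> (real (Suc n)) - mean_depth \<beta> (real v)) / real (w + 1) - 1\<bar> \<le> \<delta>"
proof -
  have "(\<lambda>n. (real n - real n powr \<beta>) powr - \<beta> * (real n powr \<beta> + 2)) \<longlonglongrightarrow> 1"
    using \<beta> by real_asymp
  then have up: "\<forall>\<^sub>F n in sequentially. (real n - real n powr \<beta>) powr - \<beta> * (real n powr \<beta> + 2) < 1 + \<delta>"
    using \<delta> by (intro order_tendstoD) auto
  have "(\<lambda>n. (real n + 1) powr - \<beta> * real n powr \<beta>) \<longlonglongrightarrow> 1"
    using \<beta> by real_asymp
  then have lo: "\<forall>\<^sub>F n in sequentially. (real n + 1) powr - \<beta> * real n powr \<beta> > 1 - \<delta>"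
    using \<delta> by (intro order_tendstoD) auto
  show ?thesis
    using up lo eventually_gt_at_top[of 1]
  proof eventually_elim
    case (elim n)
    define w where "w = nat \<lfloor>real n powr \<beta>\<rfloor>"
    have "real n powr \<beta> < real n powr 1"
      using elim \<beta> by (intro powr_less_mono) auto
    then have lt: "real n powr \<beta> < real n" using elim by simp
    have w: "real w \<le> real n powr \<beta>" "real n powr \<beta> \<le> real w + 1"
      unfolding w_def by (auto simp: of_nat_floor)
    then have wn: "w < n" using lt by linarith
    let ?x = "\<lambda>v. mean_depth \<beta> (Suc n) - mean_depth \<beta> (real v)"
    let ?a = "real (Suc n) powr - \<beta>" and ?b = "(real n - real n powr \<beta>) powr - \<beta>"
    have b: "?b * (real w + 2) \<le> 1 + \<delta>"
      by (rule order.trans[OF mult_left_mono less_imp_le[OF elim(1)]]) (use w in auto)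
    have bounds: "2 * ?a * (real (Suc n) - real v) \<le> ?x v" "?x v \<le> 2 * ?b * (real (Suc n) - real v)"
      if v: "v \<in> {n - w..n}" for v
    proof -
      have v0: "real n - real n powr \<beta> \<le> real v" using v w wn by auto
      have v1: "0 < real v" "real v < real (Suc n)" using v wn by auto
      show "2 * ?a * (real (Suc n) - real v) \<le> ?x v"
        using mean_depth_diff_bounds(1)[OF \<beta> v1] .
      have "?x v \<le> 2 * real v powr - \<beta> * (real (Suc n) - real v)"
        using mean_depth_diff_bounds(2)[OF \<beta> v1] .
      also have "\<dots> \<le> 2 * ?b * (real (Suc n) - real v)"
        using v0 v1 lt \<beta> by (intro mult_right_mono mult_left_mono powr_mono2') auto
      finally show "?x v \<le> 2 * ?b * (real (Suc n) - real v)" .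
    qed
    have "0 \<le> ?x v \<and> ?x v \<le> 3" if v: "v \<in> {n - w..n}" for v
    proof
      show "0 \<le> ?x v" by (rule order.trans[OF _ bounds(1)[OF v]]) (use v in auto)
      have "?b * (real (Suc n) - real v) \<le> ?b * (real w + 2)"
        using v wn by (intro mult_left_mono) auto
      then show "?x v \<le> 3" using bounds(2)[OF v] b \<delta> by linarith
    qed
    moreover have "(\<Sum>v\<in>{n - w..n}. ?x v) / real (w + 1) \<le> 1 + \<delta>"
    proof -
      have "(\<Sum>v\<in>{n - w..n}. ?x v) \<le> (\<Sum>v\<in>{n - w..n}. 2 * ?b * (real (Suc n) - real v))"
        using bounds(2) by (rule sum_mono)
      also have "\<dots> = real (w + 1) * (?b * (real w + 2))"
        using wn by (simp add: sum_distrib_left[symmetric] sum_steps del: of_nat_Suc)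
      also have "\<dots> \<le> real (w + 1) * (1 + \<delta>)" using b by (rule mult_left_mono) simp
      finally show ?thesis by (simp add: field_simps)
    qed
    moreover have "1 - \<delta> \<le> (\<Sum>v\<in>{n - w..n}. ?x v) / real (w + 1)"
    proof -
      have "1 - \<delta> \<le> ?a * (real w + 2)"
        by (rule order.trans[OF less_imp_le[OF elim(2)]]) (use w in \<open>auto intro!: mult_mono simp: add.commute\<close>)
      then have "real (w + 1) * (1 - \<delta>) \<le> real (w + 1) * (?a * (real w + 2))" by (rule mult_left_mono) simp
      also have "\<dots> = (\<Sum>v\<in>{n - w..n}. 2 * ?a * (real (Suc n) - real v))"
        using wn by (simp add: sum_distrib_left[symmetric] sum_steps del: of_nat_Suc)
      also have "\<dots> \<le> (\<Sum>v\<in>{n - w..n}. ?x v)"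
        using bounds(1) by (rule sum_mono)
      finally show ?thesis by (simp add: field_simps)
    qed
    ultimately show ?case using wn by (auto simp: w_def abs_le_iff)
  qed
qed

text \<open>The map is \<open>v \<mapsto> c * mean_depth \<beta> v = (v / n) powr (1 - \<beta>)\<close>. Each of the hypotheses on depths and distances
  contributes \<open>2 * \<eta> * n powr (1 - \<beta>)\<close> to its distortion, and \<open>c * n powr (1 - \<beta>) \<le> 1 / 2\<close>.\<close>

lemma (in rooted_tree) GH_dist_unit_segment_le:
  assumes \<beta>: "0 < \<beta>" "\<beta> < 1" and n: "1 \<le> n" and \<eta>: "0 < \<eta>"
    and dp: "\<And>v. v \<in> {1..n} \<Longrightarrow> \<bar>real (depth p v) - mean_depth \<beta> v\<bar> \<le> \<eta> * real n powr (1 - \<beta>)"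
    and dist: "\<And>a b. 1 \<le> b \<Longrightarrow> b \<le> a \<Longrightarrow> a \<le> n \<Longrightarrow>
      real (d a b) \<le> real (depth p a) - real (depth p b) + 2 * \<eta> * real n powr (1 - \<beta>)"
    and r: "\<eta> + real n powr - (1 - \<beta>) < r"
  shows "GH_dist (scale_metric ((1 - \<beta>) / 2 * real n powr - (1 - \<beta>)) (tree_metric p n)) unit_segment \<le> r"
proof -
  define c where "c = (1 - \<beta>) / 2 * real n powr - (1 - \<beta>)"
  define A where "A = real n powr (1 - \<beta>)"
  define t where "t v = c * mean_depth \<beta> (real v)" for v :: nat
  have c: "0 < c" using n \<beta> by (simp add: c_def)
  have "c * A = (1 - \<beta>) / 2 * (real n powr - (1 - \<beta>) * real n powr (1 - \<beta>))"
    by (simp add: c_def A_def)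
  also have "real n powr - (1 - \<beta>) * real n powr (1 - \<beta>) = 1"
    using n by (simp flip: powr_add)
  finally have cA: "c * A = (1 - \<beta>) / 2" by simp
  have t_eq: "t v = real n powr - (1 - \<beta>) * real v powr (1 - \<beta>)" for v
    using \<beta> by (simp add: t_def c_def mean_depth_def)
  have t1: "t n = 1" using n by (simp add: t_eq flip: powr_add)
  have t_mono: "t u \<le> t v" if "u \<le> v" for u v
    using that \<beta> by (auto simp: t_eq intro!: mult_left_mono powr_mono2)
  have t_range: "0 \<le> t v" "v \<le> n \<Longrightarrow> t v \<le> 1" for v
    using t_mono[of v n] t1 by (auto simp: t_eq)
  have t_step: "t (Suc v) \<le> t v + real n powr - (1 - \<beta>)" for v
  proof -
    have "real n powr - (1 - \<beta>) * real (Suc v) powr (1 - \<beta>) \<le>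
        real n powr - (1 - \<beta>) * (real v powr (1 - \<beta>) + 1)"
      using powr_add_one_le[of "real v" "1 - \<beta>"] \<beta> by (intro mult_left_mono) (auto simp: add.commute)
    then show ?thesis by (simp add: t_eq algebra_simps)
  qed
  have space: "mspace (scale_metric c (tree_metric p n)) = {1..n}"
    "mdist (scale_metric c (tree_metric p n)) = (\<lambda>u v. c * real (d u v))"
    by (simp_all only: scale_metric_simps[OF c] tree_metric_def mspace_metric mdist_metric)
  have distortion: "\<bar>c * real (d u v) - \<bar>t u - t v\<bar>\<bar> \<le> 2 * \<eta>"
    if "1 \<le> v" "v \<le> u" "u \<le> n" for u v
  proof -
    have lower: "real (depth p u) - real (depth p v) \<le> real (d u v)"
      using depth_diff_le_d[of u v] that by auto
    have "\<bar>real (d u v) - (mean_depth \<beta> u - mean_depth \<beta> v)\<bar> \<le> 4 * (\<eta> * A)"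
      using dp[of u] dp[of v] dist[of v u] that lower \<eta> unfolding A_def[symmetric]
      by (auto simp: abs_le_iff)
    then have "c * \<bar>real (d u v) - (mean_depth \<beta> u - mean_depth \<beta> v)\<bar> \<le> c * (4 * (\<eta> * A))"
      using c by (intro mult_left_mono) auto
    also have "\<dots> = 4 * \<eta> * (c * A)" by simp
    also have "\<dots> \<le> 4 * \<eta> * (1 / 2)" unfolding cA using \<eta> \<beta> by (intro mult_left_mono) auto
    finally have "\<bar>c * real (d u v) - (t u - t v)\<bar> \<le> 2 * \<eta>"
      using c by (simp add: t_def abs_mult_pos' algebra_simps)
    then show ?thesis using t_mono[of v u] that by simp
  qed
  show ?thesis
    unfolding c_def[symmetric]
  proof (rule GH_dist_le_of_approx_isometry[where t = t, OF _ \<eta> _ _ _ r])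
    show "mspace (scale_metric c (tree_metric p n)) \<noteq> {}" using n by (simp add: space)
    show "t v \<in> mspace unit_segment" if "v \<in> mspace (scale_metric c (tree_metric p n))" for v
      using that t_range[of v] by (simp add: space unit_segment_def)
    show "\<bar>mdist (scale_metric c (tree_metric p n)) u v - mdist unit_segment (t u) (t v)\<bar> \<le> 2 * \<eta>"
      if "u \<in> mspace (scale_metric c (tree_metric p n))" "v \<in> mspace (scale_metric c (tree_metric p n))" for u v
      using distortion[of u v] distortion[of v u] that d_commute[of u v]
      by (cases "u \<le> v") (auto simp: space unit_segment_def dist_real_def abs_minus_commute)
    show "\<exists>v\<in>mspace (scale_metric c (tree_metric p n)). mdist unit_segment (t v) y \<le> real n powr - (1 - \<beta>)"
      if "y \<in> mspace unit_segment" for y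
    proof -
      have y: "0 \<le> y" "y \<le> t n" using that t1 by (simp_all add: unit_segment_def)
      define v where "v = (LEAST v. y \<le> t v)"
      have v: "y \<le> t v" "v \<le> n" unfolding v_def by (rule LeastI[of _ n] Least_le, fact)+
      have "\<exists>v\<in>{1..n}. \<bar>t v - y\<bar> \<le> real n powr - (1 - \<beta>)"
      proof (cases v)
        case 0
        then have "y = 0" using v y by (simp add: t_eq)
        then show ?thesis using n by (intro bexI[of _ 1]) (simp_all add: t_eq)
      next
        case (Suc u)
        then have "t u < y" using not_less_Least[of u "\<lambda>v. y \<le> t v"] by (simp add: v_def)
        then show ?thesis using t_step[of u] v Suc by (intro bexI[of _ v]) auto
      qed
      then show ?thesis by (simp add: space unit_segment_def dist_real_def)
    qed
  qed
qed

section \<open>Concentration of the depth\<close>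

lemma exp_le_quadratic:
  fixes z :: real
  assumes "\<bar>z\<bar> \<le> 1"
  shows "exp z \<le> 1 + z + z\<^sup>2"
proof (cases "0 \<le> z")
  case True
  with assms show ?thesis by (intro exp_bound) auto
next
  case False
  have "(1 + z + z\<^sup>2) * (1 - z) = 1 - z ^ 3" by (simp add: algebra_simps power2_eq_square power3_eq_cube)
  moreover have "z ^ 3 \<le> 0" using False by (simp add: power3_eq_cube mult_nonpos_nonpos mult_nonneg_nonpos)
  ultimately have "1 \<le> (1 + z + z\<^sup>2) * (1 - z)" by simp
  also have "\<dots> \<le> (1 + z + z\<^sup>2) * exp (- z)"
  proof (rule mult_left_mono)
    show "0 \<le> 1 + z + z\<^sup>2" using assms by (smt (verit) zero_le_power2)
  qed (use exp_ge_add_one_self[of "- z"] in simp)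
  finally have "1 * exp z \<le> (1 + z + z\<^sup>2) * exp (- z) * exp z" by (rule mult_right_mono) simp
  then show ?thesis by (simp add: mult.assoc flip: exp_add)
qed

text \<open>One step of the Chernoff argument; \<open>x v\<close> stands for the increment of \<open>mean_depth\<close> over the edge to the
  parent \<open>v\<close>. To first order the exponent averages to at most \<open>- l * \<epsilon> / 2\<close> where \<open>l = \<epsilon> / 72\<close>, since the
  mean of \<open>x\<close> is 1 up to \<open>\<epsilon> / 4\<close>. The second-order term is at most \<open>(6 * l)\<^sup>2\<close>, and \<open>l\<close> is the value at
  which \<open>36 * l\<^sup>2 = l * \<epsilon> / 2\<close>. The sign \<open>\<sigma>\<close> selects the upper or the lower tail.\<close>

lemma drift_bound:
  fixes x :: "'i \<Rightarrow> real" and \<epsilon> \<sigma> :: real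
  assumes S: "finite S" "S \<noteq> {}" and \<epsilon>: "0 < \<epsilon>" "\<epsilon> < 1" and \<sigma>: "\<sigma> \<in> {1, -1}"
    and x: "\<And>v. v \<in> S \<Longrightarrow> 0 \<le> x v \<and> x v \<le> 3"
    and mean: "\<bar>(\<Sum>v\<in>S. x v) / card S - 1\<bar> \<le> \<epsilon> / 4"
  shows "(\<Sum>v\<in>S. exp (\<sigma> * (\<epsilon> / 72) * (1 - (1 + \<sigma> * \<epsilon>) * x v))) \<le> card S"
proof -
  define l \<kappa> m where "l = \<epsilon> / 72" and "\<kappa> = 1 + \<sigma> * \<epsilon>" and "m = (\<Sum>v\<in>S. x v) / card S"
  have l: "0 < l" and \<kappa>: "0 \<le> \<kappa>" "\<kappa> \<le> 2" using \<epsilon> \<sigma> by (auto simp: l_def \<kappa>_def)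
  have card: "0 < real (card S)" using S by (simp add: card_gt_0_iff)
  have "exp (\<sigma> * l * (1 - \<kappa> * x v)) \<le> exp (\<sigma> * l) * (1 - \<sigma> * l * \<kappa> * x v + 36 * l\<^sup>2)" if v: "v \<in> S" for v
  proof -
    let ?z = "- (\<sigma> * l * \<kappa> * x v)"
    have "\<kappa> * x v \<le> 2 * 3" using \<kappa> x[OF v] by (intro mult_mono) auto
    then have kx: "l * (\<kappa> * x v) \<le> l * 6" using l by simp
    have abs: "\<bar>?z\<bar> = l * (\<kappa> * x v)" using \<sigma> l \<kappa> x[OF v] by (auto simp: abs_mult)
    have "?z\<^sup>2 \<le> (l * 6)\<^sup>2"
      using kx unfolding abs[symmetric] by (rule power2_le_iff_abs_le[THEN iffD2, rotated]) (use l in simp)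
    moreover have "\<bar>?z\<bar> \<le> 1" unfolding abs using kx \<epsilon> unfolding l_def by linarith
    ultimately have "exp ?z \<le> 1 + ?z + 36 * l\<^sup>2"
      using exp_le_quadratic[of ?z] by (simp add: power_mult_distrib)
    then have "exp (\<sigma> * l) * exp ?z \<le> exp (\<sigma> * l) * (1 + ?z + 36 * l\<^sup>2)" by simp
    then show ?thesis by (simp add: algebra_simps flip: exp_add)
  qed
  then have "(\<Sum>v\<in>S. exp (\<sigma> * l * (1 - \<kappa> * x v))) \<le> (\<Sum>v\<in>S. exp (\<sigma> * l) * (1 - \<sigma> * l * \<kappa> * x v + 36 * l\<^sup>2))"
    by (rule sum_mono)
  also have "\<dots> = exp (\<sigma> * l) * (card S * (1 + 36 * l\<^sup>2) - \<sigma> * l * \<kappa> * (\<Sum>v\<in>S. x v))"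
  proof -
    have "(\<Sum>v\<in>S. 1 - \<sigma> * l * \<kappa> * x v + 36 * l\<^sup>2) = card S * (1 + 36 * l\<^sup>2) - \<sigma> * l * \<kappa> * (\<Sum>v\<in>S. x v)"
      by (simp add: sum.distrib sum_subtractf sum_distrib_left distrib_left)
    then show ?thesis by (simp flip: sum_distrib_left)
  qed
  also have "\<dots> = exp (\<sigma> * l) * (1 + 36 * l\<^sup>2 - \<sigma> * l * \<kappa> * m) * card S"
    using card by (simp add: m_def field_simps)
  also have "\<dots> \<le> 1 * real (card S)"
  proof (rule mult_right_mono)
    have m: "\<bar>m - 1\<bar> \<le> \<epsilon> / 4" using mean by (simp add: m_def)
    have "\<sigma> * \<kappa> * m = \<sigma> * m + \<epsilon> * m" using \<sigma> by (auto simp: \<kappa>_def algebra_simps)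
    moreover have "\<sigma> * m \<ge> \<sigma> - \<epsilon> / 4" using m \<sigma> unfolding abs_le_iff by auto
    moreover have "\<epsilon> * m \<ge> \<epsilon> * (3 / 4)" using m \<epsilon> unfolding abs_le_iff by (intro mult_left_mono) auto
    ultimately have "\<sigma> * \<kappa> * m \<ge> \<sigma> + \<epsilon> / 2" by simp
    then have "l * (\<sigma> * \<kappa> * m) \<ge> l * (\<sigma> + \<epsilon> / 2)" using l by simp
    moreover have "36 * l\<^sup>2 = l * (\<epsilon> / 2)" by (simp add: l_def power2_eq_square)
    ultimately have "1 + 36 * l\<^sup>2 - \<sigma> * l * \<kappa> * m \<le> 1 + - (\<sigma> * l)" by (simp add: algebra_simps)
    also have "\<dots> \<le> exp (- (\<sigma> * l))" by (rule exp_ge_add_one_self)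
    finally have "exp (\<sigma> * l) * (1 + 36 * l\<^sup>2 - \<sigma> * l * \<kappa> * m) \<le> exp (\<sigma> * l) * exp (- (\<sigma> * l))" by simp
    then show "exp (\<sigma> * l) * (1 + 36 * l\<^sup>2 - \<sigma> * l * \<kappa> * m) \<le> 1" by (simp flip: exp_add)
  qed simp
  finally show ?thesis by (simp add: l_def \<kappa>_def)
qed

locale mesoscopic_trees = limited_memory_trees M "\<lambda>n. int n - \<lfloor>real n powr \<beta>\<rfloor>" V
  for M :: "'w measure" and \<beta> :: real and V +
  assumes \<beta>_pos: "0 < \<beta>" and \<beta>_less: "\<beta> < 1 / 2"
begin

abbreviation j :: "nat \<Rightarrow> int" where "j n \<equiv> int n - \<lfloor>real n powr \<beta>\<rfloor>"

lemma mono_j: "mono j"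
proof (rule mono_iff_le_Suc[THEN iffD2], rule allI)
  fix n
  have "real (Suc n) powr \<beta> \<le> real n powr \<beta> + 1"
    using powr_add_one_le[of "real n" \<beta>] \<beta>_pos \<beta>_less by (simp add: add.commute)
  then have "\<lfloor>real (Suc n) powr \<beta>\<rfloor> \<le> \<lfloor>real n powr \<beta>\<rfloor> + 1" by linarith
  then show "j n \<le> j (Suc n)" by simp
qed

lemma j_le: "j n \<le> int n"
  by simp

lemma window_eq:
  assumes "nat \<lfloor>real n powr \<beta>\<rfloor> < n"
  shows "window n = {n - nat \<lfloor>real n powr \<beta>\<rfloor>..n}"
proof -
  have "j n = int (n - nat \<lfloor>real n powr \<beta>\<rfloor>)" using assms by (simp add: of_nat_diff)
  then have "j n \<le> int v \<longleftrightarrow> n - nat \<lfloor>real n powr \<beta>\<rfloor> \<le> v" for v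
    by (simp only: of_nat_le_iff)
  then have "window n = {v \<in> {1..n}. n - nat \<lfloor>real n powr \<beta>\<rfloor> \<le> v}"
    unfolding window_def by simp
  moreover have "{v \<in> {1..n}. n - w \<le> v} = {n - w..n}" if "w < n" for w using that by auto
  ultimately show ?thesis using assms by simp
qed

lemma card_window_le:
  assumes "m \<le> N"
  shows "card (window m) \<le> nat \<lfloor>real N powr \<beta>\<rfloor> + 1"
proof -
  have "card {m - w..m} \<le> w + 1" for w by simp
  moreover have "window m \<subseteq> {m - nat \<lfloor>real m powr \<beta>\<rfloor>..m}" by (auto simp: window_def)
  then have "card (window m) \<le> card {m - nat \<lfloor>real m powr \<beta>\<rfloor>..m}"
    by (intro card_mono) auto
  moreover have "\<lfloor>real m powr \<beta>\<rfloor> \<le> \<lfloor>real N powr \<beta>\<rfloor>"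
    using assms \<beta>_pos by (intro floor_mono powr_mono2) auto
  then have "nat \<lfloor>real m powr \<beta>\<rfloor> \<le> nat \<lfloor>real N powr \<beta>\<rfloor>"
    by (rule nat_mono)
  ultimately show ?thesis
    by (meson add_le_mono1 order.trans)
qed

text \<open>By \<open>drift_bound\<close> the exponential moment at a vertex does not exceed the largest one at earlier vertices,
  except for the finitely many vertices whose windows are too small for the asymptotics; the sum over
  these is a crude bound for all.\<close>

lemma depth_exp_moment:
  assumes \<epsilon>: "0 < \<epsilon>" "\<epsilon> < 1" and \<sigma>: "\<sigma> \<in> {1, -1}"
  shows "\<exists>K. \<forall>n. expectation (\<lambda>\<omega>. exp (\<sigma> * (\<epsilon> / 72) * (real (depth (\<lambda>k. V k \<omega>) n) - (1 + \<sigma> * \<epsilon>) * mean_depth \<beta> n))) \<le> K"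
proof -
  define g where "g n p = exp (\<sigma> * (\<epsilon> / 72) * (real (depth p n) - (1 + \<sigma> * \<epsilon>) * mean_depth \<beta> n))" for n and p :: "nat \<Rightarrow> nat"
  define E where "E n = expectation (\<lambda>\<omega>. g n (\<lambda>k. V k \<omega>))" for n
  have E_nonneg: "0 \<le> E n" for n by (simp add: E_def g_def)
  obtain n0 where n0: "\<And>n. n \<ge> n0 \<Longrightarrow> \<forall>w. w = nat \<lfloor>real n powr \<beta>\<rfloor> \<longrightarrow> w < n \<and>
    (\<forall>v\<in>{n - w..n}. 0 \<le> mean_depth \<beta> (real (Suc n)) - mean_depth \<beta> (real v) \<and> mean_depth \<beta> (real (Suc n)) - mean_depth \<beta> (real v) \<le> 3) \<and>
    \<bar>(\<Sum>v\<in>{n - w..n}. mean_depth \<beta> (real (Suc n)) - mean_depth \<beta> (real v)) / real (w + 1) - 1\<bar> \<le> \<epsilon> / 4"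
    using eventually_mean_depth_increments[of \<beta> "\<epsilon> / 4"] \<beta>_pos \<beta>_less \<epsilon>
    unfolding eventually_sequentially by auto
  define K where "K = (\<Sum>n\<le>n0. E n)"
  have "E n \<le> K" for n
  proof (induction n rule: less_induct)
    case (less n)
    show ?case
    proof (cases "n \<le> n0")
      case True
      then show ?thesis unfolding K_def using E_nonneg by (intro member_le_sum) auto
    next
      case False
      define m where "m = n - 1"
      have m: "n = Suc m" "n0 \<le> m" using False by (auto simp: m_def)
      let ?x = "\<lambda>v. mean_depth \<beta> (Suc m) - mean_depth \<beta> (real v)"
      define w where "w = nat \<lfloor>real m powr \<beta>\<rfloor>"
      have w: "w < m" "\<And>v. v \<in> {m - w..m} \<Longrightarrow> 0 \<le> ?x v \<and> ?x v \<le> 3"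
        "\<bar>(\<Sum>v\<in>{m - w..m}. ?x v) / real (w + 1) - 1\<bar> \<le> \<epsilon> / 4"
        using n0[OF m(2)] unfolding w_def by blast+
      have win: "window m = {m - w..m}" unfolding w_def using w(1) by (intro window_eq) (simp add: w_def)
      have card: "card (window m) = w + 1" unfolding win using w(1) by simp
      define G where "G v p = exp (\<sigma> * (\<epsilon> / 72) * (real (Suc (depth p (min v m))) - (1 + \<sigma> * \<epsilon>) * mean_depth \<beta> n))"
        for v and p :: "nat \<Rightarrow> nat"
      have "E n = expectation (\<lambda>\<omega>. G (V m \<omega>) (\<lambda>k. V k \<omega>))"
        unfolding E_def g_def G_def m(1) using w(1) by (simp add: depth_Suc)
      also have "\<dots> = (\<Sum>v\<in>window m. expectation (\<lambda>\<omega>. G v (\<lambda>k. V k \<omega>))) / card (window m)"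
      proof (rule expectation_choice)
        show "1 \<le> m" using w(1) by simp
        show "G v p = G v q" if "\<And>k. k \<in> {1..<m} \<Longrightarrow> p k = q k" for v p q
          unfolding G_def using that by (subst depth_cong[of "min v m" p q]) auto
        show "\<bar>G v p\<bar> \<le> exp (\<epsilon> / 72 * (real (Suc m) + \<bar>(1 + \<sigma> * \<epsilon>) * mean_depth \<beta> n\<bar>))" for v p
        proof -
          have "real (Suc (depth p (min v m))) \<le> real (Suc m)" using depth_le[of p "min v m"] by simp
          then have "\<bar>\<sigma> * (real (Suc (depth p (min v m))) - (1 + \<sigma> * \<epsilon>) * mean_depth \<beta> n)\<bar>
              \<le> real (Suc m) + \<bar>(1 + \<sigma> * \<epsilon>) * mean_depth \<beta> n\<bar>"
            using \<sigma> by (auto simp: abs_le_iff)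
          then have "\<sigma> * (real (Suc (depth p (min v m))) - (1 + \<sigma> * \<epsilon>) * mean_depth \<beta> n)
              \<le> real (Suc m) + \<bar>(1 + \<sigma> * \<epsilon>) * mean_depth \<beta> n\<bar>" by (simp only: abs_le_iff)
          from mult_left_mono[OF this, of "\<epsilon> / 72"] show ?thesis
            using \<epsilon> unfolding G_def by (simp add: mult_ac)
        qed
      qed (rule j_le)
      finally have E: "E n = (\<Sum>v\<in>window m. expectation (\<lambda>\<omega>. G v (\<lambda>k. V k \<omega>))) / card (window m)" .
      have "(\<Sum>v\<in>window m. expectation (\<lambda>\<omega>. G v (\<lambda>k. V k \<omega>))) =
          (\<Sum>v\<in>window m. E v * exp (\<sigma> * (\<epsilon> / 72) * (1 - (1 + \<sigma> * \<epsilon>) * ?x v)))"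
      proof (rule sum.cong[OF refl])
        fix v assume "v \<in> window m"
        then have "min v m = v" by (simp add: window_def)
        then have "G v p = g v p * exp (\<sigma> * (\<epsilon> / 72) * (1 - (1 + \<sigma> * \<epsilon>) * ?x v))" for p
          unfolding G_def g_def m(1) by (simp add: algebra_simps flip: exp_add)
        then show "expectation (\<lambda>\<omega>. G v (\<lambda>k. V k \<omega>)) = E v * exp (\<sigma> * (\<epsilon> / 72) * (1 - (1 + \<sigma> * \<epsilon>) * ?x v))"
          by (simp add: E_def)
      qed
      also have "\<dots> \<le> (\<Sum>v\<in>window m. K * exp (\<sigma> * (\<epsilon> / 72) * (1 - (1 + \<sigma> * \<epsilon>) * ?x v)))"
        using less m(1) by (intro sum_mono mult_right_mono) (auto simp: window_def)
      also have "\<dots> = K * (\<Sum>v\<in>window m. exp (\<sigma> * (\<epsilon> / 72) * (1 - (1 + \<sigma> * \<epsilon>) * ?x v)))"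
        by (rule sum_distrib_left[symmetric])
      also have "\<dots> \<le> K * card (window m)"
      proof (rule mult_left_mono)
        show "(\<Sum>v\<in>window m. exp (\<sigma> * (\<epsilon> / 72) * (1 - (1 + \<sigma> * \<epsilon>) * ?x v))) \<le> card (window m)"
        proof (rule drift_bound[OF _ _ \<epsilon> \<sigma>])
          show "window m \<noteq> {}" using card by auto
          show "0 \<le> ?x v \<and> ?x v \<le> 3" if "v \<in> window m" for v
            using that unfolding win by (rule w(2))
          show "\<bar>(\<Sum>v\<in>window m. ?x v) / card (window m) - 1\<bar> \<le> \<epsilon> / 4"
            unfolding card unfolding win by (rule w(3))
        qed simp
        show "0 \<le> K" unfolding K_def by (rule sum_nonneg) (rule E_nonneg)
      qed
      finally show ?thesis unfolding E using card by (subst pos_divide_le_eq) auto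
    qed
  qed
  then show ?thesis unfolding E_def g_def by blast
qed

lemma depth_tail:
  assumes \<epsilon>: "0 < \<epsilon>" "\<epsilon> < 1"
  shows "\<exists>K. \<forall>n x. prob {\<omega> \<in> space M. \<bar>real (depth (\<lambda>k. V k \<omega>) n) - mean_depth \<beta> n\<bar> > \<epsilon> * mean_depth \<beta> n + x}
    \<le> K * exp (- (\<epsilon> / 72 * x))"
proof -
  let ?h = "\<lambda>\<omega> n. real (depth (\<lambda>k. V k \<omega>) n)"
  define Y where "Y \<sigma> n \<omega> = \<sigma> * (\<epsilon> / 72) * (?h \<omega> n - (1 + \<sigma> * \<epsilon>) * mean_depth \<beta> n)" for \<sigma> n \<omega>
  obtain K1 where K1: "\<And>n. expectation (\<lambda>\<omega>. exp (Y 1 n \<omega>)) \<le> K1"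
    using depth_exp_moment[OF \<epsilon>, of 1] unfolding Y_def by blast
  obtain K2 where K2: "\<And>n. expectation (\<lambda>\<omega>. exp (Y (- 1) n \<omega>)) \<le> K2"
    using depth_exp_moment[OF \<epsilon>, of "- 1"] unfolding Y_def by blast
  have meas [measurable]: "Y \<sigma> n \<in> borel_measurable M" for \<sigma> n
  proof -
    have "(\<lambda>\<omega>. depth (\<lambda>k. V k \<omega>) n) \<in> measurable M (count_space UNIV)"
      by (rule measurable_choices[of n "\<lambda>p. depth p n"]) (rule depth_cong)
    from measurable_compose[OF this, of "\<lambda>h. \<sigma> * (\<epsilon> / 72) * (real h - (1 + \<sigma> * \<epsilon>) * mean_depth \<beta> n)" borel]
    show ?thesis by (simp add: Y_def[abs_def])
  qed
  have markov: "prob {\<omega> \<in> space M. \<epsilon> / 72 * x \<le> Y \<sigma> n \<omega>} \<le> expectation (\<lambda>\<omega>. exp (Y \<sigma> n \<omega>)) * exp (- (\<epsilon> / 72 * x))" for \<sigma> n x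
  proof -
    have int: "integrable M (\<lambda>\<omega>. exp (Y \<sigma> n \<omega>))"
    proof (rule integrable_const_bound)
      show "AE \<omega> in M. norm (exp (Y \<sigma> n \<omega>)) \<le> exp (\<bar>\<sigma> * (\<epsilon> / 72)\<bar> * (real n + \<bar>(1 + \<sigma> * \<epsilon>) * mean_depth \<beta> n\<bar>))"
      proof (rule AE_I2)
        fix \<omega>
        have "\<bar>?h \<omega> n - (1 + \<sigma> * \<epsilon>) * mean_depth \<beta> n\<bar> \<le> real n + \<bar>(1 + \<sigma> * \<epsilon>) * mean_depth \<beta> n\<bar>"
          using depth_le[of "\<lambda>k. V k \<omega>" n] by linarith
        then have "\<bar>Y \<sigma> n \<omega>\<bar> \<le> \<bar>\<sigma> * (\<epsilon> / 72)\<bar> * (real n + \<bar>(1 + \<sigma> * \<epsilon>) * mean_depth \<beta> n\<bar>)"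
          unfolding Y_def abs_mult[of "\<sigma> * (\<epsilon> / 72)"] by (rule mult_left_mono) simp
        then show "norm (exp (Y \<sigma> n \<omega>)) \<le> exp (\<bar>\<sigma> * (\<epsilon> / 72)\<bar> * (real n + \<bar>(1 + \<sigma> * \<epsilon>) * mean_depth \<beta> n\<bar>))"
          by simp
      qed
    qed simp
    have "prob {\<omega> \<in> space M. exp (\<epsilon> / 72 * x) \<le> exp (Y \<sigma> n \<omega>)} \<le> expectation (\<lambda>\<omega>. exp (Y \<sigma> n \<omega>)) / exp (\<epsilon> / 72 * x)"
      using int by (rule integral_Markov_inequality_measure[where A = "{}"]) auto
    then show ?thesis by (simp add: exp_minus field_simps)
  qed
  have "prob {\<omega> \<in> space M. \<bar>?h \<omega> n - mean_depth \<beta> n\<bar> > \<epsilon> * mean_depth \<beta> n + x} \<le> (K1 + K2) * exp (- (\<epsilon> / 72 * x))" for n x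
  proof -
    have Y_eq: "Y 1 n \<omega> = \<epsilon> / 72 * (?h \<omega> n - (1 + \<epsilon>) * mean_depth \<beta> n)"
      "Y (- 1) n \<omega> = \<epsilon> / 72 * ((1 - \<epsilon>) * mean_depth \<beta> n - ?h \<omega> n)" for \<omega>
      by (simp_all add: Y_def algebra_simps)
    have sub: "{\<omega> \<in> space M. \<bar>?h \<omega> n - mean_depth \<beta> n\<bar> > \<epsilon> * mean_depth \<beta> n + x} \<subseteq>
        {\<omega> \<in> space M. \<epsilon> / 72 * x \<le> Y 1 n \<omega>} \<union> {\<omega> \<in> space M. \<epsilon> / 72 * x \<le> Y (- 1) n \<omega>}"
    proof
      fix \<omega> assume \<omega>: "\<omega> \<in> {\<omega> \<in> space M. \<bar>?h \<omega> n - mean_depth \<beta> n\<bar> > \<epsilon> * mean_depth \<beta> n + x}"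
      then consider "x \<le> ?h \<omega> n - (1 + \<epsilon>) * mean_depth \<beta> n" | "x \<le> (1 - \<epsilon>) * mean_depth \<beta> n - ?h \<omega> n"
        by (auto simp: abs_if algebra_simps split: if_splits)
      then have "\<epsilon> / 72 * x \<le> Y 1 n \<omega> \<or> \<epsilon> / 72 * x \<le> Y (- 1) n \<omega>"
      proof cases
        case 1
        then have "\<epsilon> / 72 * x \<le> Y 1 n \<omega>" unfolding Y_eq using \<epsilon> by (intro mult_left_mono) auto
        then show ?thesis ..
      next
        case 2
        then have "\<epsilon> / 72 * x \<le> Y (- 1) n \<omega>" unfolding Y_eq using \<epsilon> by (intro mult_left_mono) auto
        then show ?thesis ..
      qed
      with \<omega> show "\<omega> \<in> {\<omega> \<in> space M. \<epsilon> / 72 * x \<le> Y 1 n \<omega>} \<union> {\<omega> \<in> space M. \<epsilon> / 72 * x \<le> Y (- 1) n \<omega>}"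
        by blast
    qed
    have sets: "{\<omega> \<in> space M. \<epsilon> / 72 * x \<le> Y \<sigma> n \<omega>} \<in> sets M" for \<sigma>
      by measurable
    have "prob {\<omega> \<in> space M. \<bar>?h \<omega> n - mean_depth \<beta> n\<bar> > \<epsilon> * mean_depth \<beta> n + x} \<le>
        prob {\<omega> \<in> space M. \<epsilon> / 72 * x \<le> Y 1 n \<omega>} + prob {\<omega> \<in> space M. \<epsilon> / 72 * x \<le> Y (- 1) n \<omega>}"
      by (rule order.trans[OF finite_measure_mono[OF sub] measure_Un_le]) (use sets in auto)
    also have "\<dots> \<le> K1 * exp (- (\<epsilon> / 72 * x)) + K2 * exp (- (\<epsilon> / 72 * x))"
      by (intro add_mono order.trans[OF markov] mult_right_mono K1 K2) simp_all
    finally show ?thesis by (simp add: distrib_right)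
  qed
  then show ?thesis by blast
qed

section \<open>Convergence to the segment\<close>

lemma merge_steps_tail_exp:
  assumes ba: "1 \<le> b" "b \<le> a" "a \<le> N"
  shows "prob {\<omega> \<in> space M. nat \<lfloor>x\<rfloor> < merge_steps j (\<lambda>i. V i \<omega>) a b} \<le> exp (- ((x - 1) / (real N powr \<beta> + 1)))"
proof -
  define q where "q = nat \<lfloor>real N powr \<beta>\<rfloor> + 1"
  define k where "k = nat \<lfloor>x\<rfloor>"
  have q: "0 < q" "real q \<le> real N powr \<beta> + 1"
    by (auto simp: q_def of_nat_floor)
  have k: "x - 1 \<le> real k" unfolding k_def by linarith
  have "prob {\<omega> \<in> space M. k < merge_steps j (\<lambda>i. V i \<omega>) a b} \<le> (1 - 1 / real q) ^ k"
  proof (rule merge_steps_tail[OF _ j_le ba])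
    show "card (window m) \<le> q" if "m \<in> {1..<N}" for m
      unfolding q_def by (rule card_window_le) (use that in simp)
  qed
  also have "\<dots> \<le> exp (- (1 / real q)) ^ k"
    using q exp_ge_add_one_self[of "- (1 / real q)"] by (intro power_mono) auto
  also have "\<dots> = exp (- (real k / real q))"
    by (simp flip: exp_of_nat_mult)
  also have "(x - 1) / (real N powr \<beta> + 1) \<le> real k / real q"
  proof -
    have "(x - 1) / (real N powr \<beta> + 1) \<le> real k / (real N powr \<beta> + 1)"
      using k by (intro divide_right_mono) auto
    also have "\<dots> \<le> real k / real q"
      using q by (intro divide_left_mono) (auto intro!: mult_pos_pos)
    finally show ?thesis .
  qed
  then have "exp (- (real k / real q)) \<le> exp (- ((x - 1) / (real N powr \<beta> + 1)))" by simp
  finally show ?thesis by (simp add: k_def)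
qed

lemma AE_limited_tree: "AE \<omega> in M. limited_tree (\<lambda>k. V k \<omega>) N j"
proof -
  have "AE \<omega> in M. \<forall>m\<in>{1..<N}. V m \<omega> \<in> window m"
    by (rule AE_finite_allI) (auto intro!: AE_choice)
  then show ?thesis
  proof eventually_elim
    case (elim \<omega>)
    show ?case
    proof
      show "V k \<omega> \<in> {1..k}" "j k \<le> int (V k \<omega>)" if "k \<in> {1..<N}" for k
        using elim[rule_format, OF that] by (simp_all add: window_def)
      show "mono j" by (rule mono_j)
    qed
  qed
qed

abbreviation GH_error :: "nat \<Rightarrow> 'w \<Rightarrow> real" where
  "GH_error N \<omega> \<equiv> GH_dist (scale_metric ((1 - \<beta>) / 2 * real N powr - (1 - \<beta>)) (tree_metric (\<lambda>k. V k \<omega>) N)) unit_segment"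

text \<open>A union bound over the vertices for the depths and over the pairs of vertices for the merging of
  ancestral lines. The tolerance \<open>\<eta> / 8\<close> is chosen because \<open>mean_depth \<beta> v \<le> 4 * N powr (1 - \<beta>)\<close>, so that
  the relative error uses up one half of \<open>\<eta> * N powr (1 - \<beta>)\<close> and the tail bound is applied to the other half.\<close>

lemma prob_GH_error_le:
  assumes \<eta>: "0 < \<eta>" "\<eta> < 1" and K: "\<And>n x. prob {\<omega> \<in> space M.
      \<bar>real (depth (\<lambda>k. V k \<omega>) n) - mean_depth \<beta> n\<bar> > \<eta> / 8 * mean_depth \<beta> n + x} \<le> K * exp (- (\<eta> / 8 / 72 * x))"
    and N: "1 \<le> N" "\<eta> + real N powr - (1 - \<beta>) < r"
  shows "prob {\<omega> \<in> space M. GH_error N \<omega> > r} \<le>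
    real N * (K * exp (- (\<eta> / 8 / 72 * (\<eta> / 2 * real N powr (1 - \<beta>))))) +
    real N * (real N * exp (- ((\<eta> * real N powr (1 - \<beta>) - 1) / (real N powr \<beta> + 1))))"
proof -
  define A where "A = real N powr (1 - \<beta>)"
  define D where "D v = {\<omega> \<in> space M. \<bar>real (depth (\<lambda>k. V k \<omega>) v) - mean_depth \<beta> v\<bar> > \<eta> / 8 * mean_depth \<beta> v + \<eta> / 2 * A}" for v
  define C where "C a b = {\<omega> \<in> space M. nat \<lfloor>\<eta> * A\<rfloor> < merge_steps j (\<lambda>k. V k \<omega>) a b}" for a b
  have D_sets: "D v \<in> sets M" for v
    unfolding D_def
    by (rule sets_choices[of v "\<lambda>p. depth p v" "\<lambda>h. \<bar>real h - mean_depth \<beta> v\<bar> > \<eta> / 8 * mean_depth \<beta> v + \<eta> / 2 * A"])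
      (rule depth_cong)
  have C_sets: "C a b \<in> sets M" for a b
    unfolding C_def
    by (rule sets_choices[of a "\<lambda>p. merge_steps j p a b" "\<lambda>h. nat \<lfloor>\<eta> * A\<rfloor> < h"]) (rule merge_steps_cong)
  let ?D = "\<Union>v\<in>{1..N}. D v" and ?C = "\<Union>a\<in>{1..N}. \<Union>b\<in>{1..a}. C a b"
  have "prob {\<omega> \<in> space M. GH_error N \<omega> > r} \<le> prob (?D \<union> ?C)"
  proof (rule finite_measure_mono_AE)
    show "?D \<union> ?C \<in> sets M" using D_sets C_sets by (intro sets.Un sets.finite_UN) auto
    show "AE \<omega> in M. \<omega> \<in> {\<omega> \<in> space M. GH_error N \<omega> > r} \<longrightarrow> \<omega> \<in> ?D \<union> ?C"
      using AE_limited_tree[of N]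
    proof eventually_elim
      case (elim \<omega>)
      interpret limited_tree "\<lambda>k. V k \<omega>" N j by fact
      show ?case
      proof (rule impI, rule ccontr)
        assume \<omega>: "\<omega> \<in> {\<omega> \<in> space M. GH_error N \<omega> > r}" and not: "\<omega> \<notin> ?D \<union> ?C"
        have "GH_error N \<omega> \<le> r"
        proof (rule GH_dist_unit_segment_le)
          fix v assume v: "v \<in> {1..N}"
          have "mean_depth \<beta> v \<le> mean_depth \<beta> N"
            using v \<beta>_pos \<beta>_less unfolding mean_depth_def by (intro mult_left_mono powr_mono2) auto
          also have "\<dots> = 2 / (1 - \<beta>) * A" by (simp add: mean_depth_def A_def)
          also have "\<dots> \<le> 4 * A"
            using \<beta>_less by (intro mult_right_mono) (auto simp: A_def field_simps)
          finally have "\<eta> / 8 * mean_depth \<beta> v \<le> \<eta> / 8 * (4 * A)" using \<eta> by (intro mult_left_mono) auto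
          moreover have "\<bar>real (depth (\<lambda>k. V k \<omega>) v) - mean_depth \<beta> v\<bar> \<le> \<eta> / 8 * mean_depth \<beta> v + \<eta> / 2 * A"
            using not v \<omega> by (auto simp: D_def not_less)
          ultimately show "\<bar>real (depth (\<lambda>k. V k \<omega>) v) - mean_depth \<beta> v\<bar> \<le> \<eta> * real N powr (1 - \<beta>)"
            by (simp add: A_def)
        next
          fix a b assume ab: "1 \<le> b" "b \<le> a" "a \<le> N"
          have "\<omega> \<notin> C a b" using not ab by auto
          then have "merge_steps j (\<lambda>k. V k \<omega>) a b \<le> nat \<lfloor>\<eta> * A\<rfloor>" using \<omega> by (simp add: C_def)
          also have "real (nat \<lfloor>\<eta> * A\<rfloor>) \<le> \<eta> * A" using \<eta> by (intro of_nat_floor) (simp add: A_def)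
          finally have merge_steps: "real (merge_steps j (\<lambda>k. V k \<omega>) a b) \<le> \<eta> * A" by simp
          have "real_of_int (int (d a b)) \<le> real_of_int (int (depth (\<lambda>k. V k \<omega>) a) - int (depth (\<lambda>k. V k \<omega>) b)
              + 2 * int (merge_steps j (\<lambda>k. V k \<omega>) a b))"
            using d_le_depth_diff_merge_steps[OF ab] by (simp only: of_int_le_iff)
          with merge_steps show "real (d a b) \<le> real (depth (\<lambda>k. V k \<omega>) a) - real (depth (\<lambda>k. V k \<omega>) b)
              + 2 * \<eta> * real N powr (1 - \<beta>)"
            by (simp add: A_def)
        qed (use \<beta>_pos \<beta>_less \<eta> N in auto)
        with \<omega> show False by simp
      qed
    qed
  qed
  also have "\<dots> \<le> prob ?D + prob ?C"
    using D_sets C_sets by (intro measure_Un_le sets.finite_UN) auto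
  finally have split: "prob {\<omega> \<in> space M. GH_error N \<omega> > r} \<le> prob ?D + prob ?C" .
  have "prob ?D \<le> (\<Sum>v\<in>{1..N}. K * exp (- (\<eta> / 8 / 72 * (\<eta> / 2 * A))))"
  proof (rule order.trans[OF measure_UNION_le sum_mono])
    show "prob (D v) \<le> K * exp (- (\<eta> / 8 / 72 * (\<eta> / 2 * A)))" for v
      unfolding D_def by (rule K)
  qed (use D_sets in auto)
  moreover have "prob ?C \<le> (\<Sum>a\<in>{1..N}. real N * exp (- ((\<eta> * A - 1) / (real N powr \<beta> + 1))))"
  proof (rule order.trans[OF measure_UNION_le sum_mono])
    fix a assume a: "a \<in> {1..N}"
    have "prob (\<Union>b\<in>{1..a}. C a b) \<le> (\<Sum>b\<in>{1..a}. exp (- ((\<eta> * A - 1) / (real N powr \<beta> + 1))))"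
    proof (rule order.trans[OF measure_UNION_le sum_mono])
      show "prob (C a b) \<le> exp (- ((\<eta> * A - 1) / (real N powr \<beta> + 1)))" if "b \<in> {1..a}" for b
        unfolding C_def by (rule merge_steps_tail_exp) (use a that in auto)
    qed (use C_sets in auto)
    also have "\<dots> = real a * exp (- ((\<eta> * A - 1) / (real N powr \<beta> + 1)))" by simp
    also have "\<dots> \<le> real N * exp (- ((\<eta> * A - 1) / (real N powr \<beta> + 1)))"
      using a by (intro mult_right_mono) auto
    finally show "prob (\<Union>b\<in>{1..a}. C a b) \<le> real N * exp (- ((\<eta> * A - 1) / (real N powr \<beta> + 1)))" .
  qed (use C_sets in auto)
  ultimately show ?thesis using split by (simp add: A_def)
qed

lemma GH_error_tendsto:
  assumes "0 < r"
  shows "(\<lambda>N. prob {\<omega> \<in> space M. GH_error N \<omega> > r}) \<longlonglongrightarrow> 0"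
proof -
  define \<eta> where "\<eta> = min (r / 2) (1 / 2)"
  have \<eta>: "0 < \<eta>" "\<eta> < 1" "\<eta> < r" using assms by (auto simp: \<eta>_def)
  obtain K where K: "\<And>n x. prob {\<omega> \<in> space M.
      \<bar>real (depth (\<lambda>k. V k \<omega>) n) - mean_depth \<beta> n\<bar> > \<eta> / 8 * mean_depth \<beta> n + x} \<le> K * exp (- (\<eta> / 8 / 72 * x))"
    using depth_tail[of "\<eta> / 8"] \<eta> by auto
  have "(\<lambda>N. real N powr - (1 - \<beta>)) \<longlonglongrightarrow> 0" using \<beta>_less by real_asymp
  then have "\<forall>\<^sub>F N in sequentially. real N powr - (1 - \<beta>) < r - \<eta>"
    using \<eta> by (intro order_tendstoD) auto
  then have bound: "\<forall>\<^sub>F N in sequentially. prob {\<omega> \<in> space M. GH_error N \<omega> > r} \<le>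
    real N * (K * exp (- (\<eta> / 8 / 72 * (\<eta> / 2 * real N powr (1 - \<beta>))))) +
    real N * (real N * exp (- ((\<eta> * real N powr (1 - \<beta>) - 1) / (real N powr \<beta> + 1))))"
    using eventually_ge_at_top[of 1]
    by eventually_elim (rule prob_GH_error_le[OF \<eta>(1,2) K]; simp)
  have "(\<lambda>N. real N * exp (- (\<eta> / 8 / 72 * (\<eta> / 2 * real N powr (1 - \<beta>))))) \<longlonglongrightarrow> 0"
    using \<eta>(1) \<beta>_pos \<beta>_less by real_asymp
  then have "(\<lambda>N. K * (real N * exp (- (\<eta> / 8 / 72 * (\<eta> / 2 * real N powr (1 - \<beta>)))))) \<longlonglongrightarrow> 0"
    by (rule tendsto_mult_right_zero)
  moreover have "(\<lambda>N. real N * (real N * exp (- ((\<eta> * real N powr (1 - \<beta>) - 1) / (real N powr \<beta> + 1))))) \<longlonglongrightarrow> 0"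
    using \<eta>(1) \<beta>_pos \<beta>_less by real_asymp
  ultimately have "(\<lambda>N. real N * (K * exp (- (\<eta> / 8 / 72 * (\<eta> / 2 * real N powr (1 - \<beta>))))) +
    real N * (real N * exp (- ((\<eta> * real N powr (1 - \<beta>) - 1) / (real N powr \<beta> + 1))))) \<longlonglongrightarrow> 0"
    using tendsto_add_zero by (simp add: mult.left_commute)
  then show ?thesis
    by (intro tendsto_sandwich[OF _ bound tendsto_const]) simp_all
qed

end

theorem theorem2p9:
  fixes \<beta> :: real and M :: "'w measure" and V :: "nat \<Rightarrow> 'w \<Rightarrow> nat"
  assumes "0 < \<beta>" and "\<beta> < 1/2"
    and "limited_memory_trees M (\<lambda>n. int n - \<lfloor>real n powr \<beta>\<rfloor>) V"
  shows "GH_tendsto_in_prob M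
           (\<lambda>n \<omega>. scale_metric ((1 - \<beta>) / 2 * real n powr (- (1 - \<beta>)))
                     (tree_metric (\<lambda>k. V k \<omega>) n))
           unit_segment"
proof -
  interpret mesoscopic_trees M \<beta> V
    using assms by (simp add: mesoscopic_trees_def mesoscopic_trees_axioms_def)
  show ?thesis
    unfolding GH_tendsto_in_prob_def using GH_error_tendsto by blast
qed

end
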